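(* PHyperLTL model checking is undecidable.
   Context: PHyperLTL is a probabilistic hyperlogic over Markov decision processes (MDPs) $M=(S,\mathit{Act},\mathcal{P},L)$. Its formulae have the form $\exists (\hat{\sigma}_1\dots\hat{\sigma}_n).\, \mathcal{Q}_1 \hat{s}_1 \in I_1(\hat{\sigma}_i)\dots \mathcal{Q}_m \hat{s}_m \in I_m(\hat{\sigma}_j).\, \phi$, with $n\le m$, $\mathcal{Q}\in\{\exists,\forall\}$, $I_k\subseteq S$, and $\phi ::= \phi\land\phi \mid \neg\phi \mid \mathbb{P}(\varphi)\bowtie c$, where $c\in[0,1]$ and $\varphi$ is an LTL formula over atomic propositions tagged with state variables. The formula asserts existence of (deterministic) policies $\sigma_1,\dots,\sigma_n$ for $M$; each agent $k$ starts in a state $\hat{s}_k$ quantified from $I_k$ and is controlled by the bound policy, and $\mathbb{P}(\varphi)\bowtie c$ holds iff the probability of the set of infinite paths satisfying $\varphi$ in the Markov chain obtained by applying the agents' policies to the $m$-fold self-composition of $M$ (the $m$ replicas evolving independently and simultaneously, labels read per replica) from the chosen initial state tuple meets $\bowtie c$. Model checking asks whether a given MDP satisfies a given formula. *)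

theory Defs
  imports "HOL-Probability.Probability" "HOL-Library.Nat_Bijection"
begin

section \<open>Markov decision processes\<close>

record ('s, 'a, 'p) mdp =
  states :: "'s set"
  acts :: "'a set"
  trans :: "'s \<Rightarrow> 'a \<Rightarrow> 's pmf"
  label :: "'s \<Rightarrow> 'p set"

definition is_mdp :: "('s, 'a, 'p) mdp \<Rightarrow> bool" where
  "is_mdp M \<longleftrightarrow>
     finite (states M) \<and> states M \<noteq> {} \<and> finite (acts M) \<and> acts M \<noteq> {} \<and>
     (\<forall>s\<in>states M. \<forall>a\<in>acts M. set_pmf (trans M s a) \<subseteq> states M) \<and>
     (\<forall>s\<in>states M. finite (label M s))"

text \<open>
  A policy is deterministic and history-dependent: it maps the nonempty sequence of the states
  visited so far (current state last) to an action. The earlier actions are not part of the history,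
  because a deterministic policy determines them from the states.
\<close>

type_synonym ('s, 'a) policy = "'s list \<Rightarrow> 'a"

definition policies :: "('s, 'a, 'p) mdp \<Rightarrow> ('s, 'a) policy set" where
  "policies M = {\<sigma>. \<forall>h. h \<noteq> [] \<and> set h \<subseteq> states M \<longrightarrow> \<sigma> h \<in> acts M}"

definition step :: "('s, 'a, 'p) mdp \<Rightarrow> ('s, 'a) policy \<Rightarrow> 's \<Rightarrow> nat \<Rightarrow> (nat \<Rightarrow> 's) \<Rightarrow> 's pmf" where
  "step M \<sigma> s0 n \<omega> =
     (case n of 0 \<Rightarrow> return_pmf s0 | Suc i \<Rightarrow> trans M (\<omega> i) (\<sigma> (map \<omega> [0..<Suc i])))"

text \<open>
  The measure on infinite paths of the Markov chain induced by a policy is the Ionescu-Tulcea limit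
  of the one-step kernels, on the product sigma algebra of discrete spaces. The state type has to be
  countable, so that every kernel is measurable.
\<close>

definition path_measure ::
  "('s, 'a, 'p) mdp \<Rightarrow> ('s, 'a) policy \<Rightarrow> 's \<Rightarrow> (nat \<Rightarrow> 's) measure" where
  "path_measure M \<sigma> s0 =
     projective_family.lim UNIV
       (Ionescu_Tulcea.CI (\<lambda>n \<omega>. measure_pmf (step M \<sigma> s0 n \<omega>)) (\<lambda>_. count_space UNIV))
       (\<lambda>_. count_space UNIV)"

lemma Ionescu_Tulcea_step:
  fixes M :: "('s::countable, 'a, 'p) mdp"
  shows "Ionescu_Tulcea (\<lambda>n \<omega>. measure_pmf (step M \<sigma> s0 n \<omega>)) (\<lambda>_. count_space UNIV)"
proof (unfold_locales, goal_cases)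
  case (1 i)
  have "(\<Pi>\<^sub>M j\<in>{0..<i}. count_space (UNIV :: 's set)) = count_space (PiE {0..<i} (\<lambda>_. UNIV))"
    by (rule count_space_PiM_finite) auto
  then show ?case
    by (auto simp: measure_pmf_in_subprob_algebra)
qed

lemma sets_path_measure:
  fixes M :: "('s::countable, 'a, 'p) mdp"
  shows "sets (path_measure M \<sigma> s0) = sets (\<Pi>\<^sub>M i\<in>(UNIV :: nat set). count_space UNIV)"
proof -
  interpret Ionescu_Tulcea "\<lambda>n \<omega>. measure_pmf (step M \<sigma> s0 n \<omega>)" "\<lambda>_. count_space UNIV"
    by (rule Ionescu_Tulcea_step)
  show ?thesis
    unfolding path_measure_def by (rule PF.sets_lim)
qed


section \<open>Self-composition\<close>

fun product_pmf :: "'s pmf list \<Rightarrow> 's list pmf" where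
  "product_pmf [] = return_pmf []"
| "product_pmf (p # ps) = map_pmf (\<lambda>(x, xs). x # xs) (pair_pmf p (product_pmf ps))"

text \<open>The proposition \<open>p\<close> of replica \<open>k\<close> is the tagged proposition \<open>(p, k)\<close>; replicas count from 0.\<close>

definition self_comp :: "nat \<Rightarrow> ('s, 'a, 'p) mdp \<Rightarrow> ('s list, 'a list, 'p \<times> nat) mdp" where
  "self_comp m M =
     \<lparr> states = {ss. length ss = m \<and> set ss \<subseteq> states M},
       acts = {as. length as = m \<and> set as \<subseteq> acts M},
       trans = (\<lambda>ss as. product_pmf (map2 (trans M) ss as)),
       label = (\<lambda>ss. {(p, k). k < length ss \<and> p \<in> label M (ss ! k)}) \<rparr>"

text \<open>Each agent sees the history of its own replica only.\<close>

definition joint_policy :: "('s, 'a) policy list \<Rightarrow> ('s list, 'a list) policy" where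
  "joint_policy \<tau>s h = map (\<lambda>k. (\<tau>s ! k) (map (\<lambda>ss. ss ! k) h)) [0..<length \<tau>s]"


section \<open>PHyperLTL\<close>

datatype 'p ltl =
    LTrue
  | LAtom 'p
  | LNot "'p ltl"
  | LAnd "'p ltl" "'p ltl"
  | LNext "'p ltl"
  | LUntil "'p ltl" "'p ltl"

primrec sat_ltl :: "(nat \<Rightarrow> 'p set) \<Rightarrow> nat \<Rightarrow> 'p ltl \<Rightarrow> bool" where
  "sat_ltl w i LTrue \<longleftrightarrow> True"
| "sat_ltl w i (LAtom p) \<longleftrightarrow> p \<in> w i"
| "sat_ltl w i (LNot \<psi>) \<longleftrightarrow> \<not> sat_ltl w i \<psi>"
| "sat_ltl w i (LAnd \<psi> \<theta>) \<longleftrightarrow> sat_ltl w i \<psi> \<and> sat_ltl w i \<theta>"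
| "sat_ltl w i (LNext \<psi>) \<longleftrightarrow> sat_ltl w (Suc i) \<psi>"
| "sat_ltl w i (LUntil \<psi> \<theta>) \<longleftrightarrow>
     (\<exists>j\<ge>i. sat_ltl w j \<theta> \<and> (\<forall>k. i \<le> k \<and> k < j \<longrightarrow> sat_ltl w k \<psi>))"

definition prob_ltl ::
  "('s, 'a, 'p) mdp \<Rightarrow> ('s, 'a) policy \<Rightarrow> 's \<Rightarrow> 'p ltl \<Rightarrow> real" where
  "prob_ltl M \<sigma> s0 \<psi> = measure (path_measure M \<sigma> s0) {\<omega>. sat_ltl (\<lambda>i. label M (\<omega> i)) 0 \<psi>}"

lemma sat_ltl_measurable:
  fixes M :: "('s::countable, 'a, 'p) mdp"
  shows "{\<omega>. sat_ltl (\<lambda>i. label M (\<omega> i)) 0 \<psi>} \<in> sets (path_measure M \<sigma> s0)"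
proof -
  let ?N = "\<Pi>\<^sub>M i\<in>(UNIV :: nat set). count_space (UNIV :: 's set)"
  have "Measurable.pred ?N (\<lambda>\<omega>. sat_ltl (\<lambda>i. label M (\<omega> i)) j \<psi>)" for j
  proof (induction \<psi> arbitrary: j)
    case (LAtom p)
    have "(\<lambda>\<omega>. p \<in> label M (\<omega> j)) = (\<lambda>s. p \<in> label M s) \<circ> (\<lambda>\<omega>. \<omega> j)"
      by auto
    also have "\<dots> \<in> measurable ?N (count_space UNIV)"
      by (intro measurable_comp[of _ _ "count_space UNIV"] measurable_component_singleton) auto
    finally show ?case
      by simp
  next
    case (LUntil \<psi> \<theta>)
    note [measurable] = LUntil.IH
    show ?case
      unfolding sat_ltl.simps by measurable
  qed simp_all
  then have "{\<omega> \<in> space ?N. sat_ltl (\<lambda>i. label M (\<omega> i)) 0 \<psi>} \<in> sets ?N"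
    by measurable
  then show ?thesis
    by (simp add: sets_path_measure space_PiM)
qed

datatype cmp = Less | LessEq | Equal | GreaterEq | Greater

fun compare :: "cmp \<Rightarrow> real \<Rightarrow> real \<Rightarrow> bool" where
  "compare Less x c \<longleftrightarrow> x < c"
| "compare LessEq x c \<longleftrightarrow> x \<le> c"
| "compare Equal x c \<longleftrightarrow> x = c"
| "compare GreaterEq x c \<longleftrightarrow> x \<ge> c"
| "compare Greater x c \<longleftrightarrow> x > c"

text \<open>Thresholds are rational, since formulae are inputs of an algorithm.\<close>

datatype 'p matrix =
    MAnd "'p matrix" "'p matrix"
  | MNot "'p matrix"
  | MProb "('p \<times> nat) ltl" cmp rat

primrec sat_matrix :: "(('p \<times> nat) ltl \<Rightarrow> real) \<Rightarrow> 'p matrix \<Rightarrow> bool" where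
  "sat_matrix P (MAnd \<phi> \<phi>') \<longleftrightarrow> sat_matrix P \<phi> \<and> sat_matrix P \<phi>'"
| "sat_matrix P (MNot \<phi>) \<longleftrightarrow> \<not> sat_matrix P \<phi>"
| "sat_matrix P (MProb \<psi> op c) \<longleftrightarrow> compare op (P \<psi>) (of_rat c)"

primrec wf_matrix :: "nat \<Rightarrow> 'p matrix \<Rightarrow> bool" where
  "wf_matrix m (MAnd \<phi> \<phi>') \<longleftrightarrow> wf_matrix m \<phi> \<and> wf_matrix m \<phi>'"
| "wf_matrix m (MNot \<phi>) \<longleftrightarrow> wf_matrix m \<phi>"
| "wf_matrix m (MProb \<psi> op c) \<longleftrightarrow> (\<forall>(p, k)\<in>set_ltl \<psi>. k < m) \<and> 0 \<le> c \<and> c \<le> 1"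

datatype quant = QEx | QAll

text \<open>
  In \<open>PHyper n ags \<phi>\<close>, the number of policy variables is \<open>n\<close>, and the \<open>k\<close>-th entry
  \<open>(Q, I, j)\<close> of \<open>ags\<close> says that the \<open>k\<close>-th state variable is quantified by \<open>Q\<close> over \<open>I\<close> and that
  its agent follows the \<open>j\<close>-th policy variable (\<open>j < n\<close>).
\<close>

datatype ('s, 'p) phyper = PHyper nat "(quant \<times> 's set \<times> nat) list" "'p matrix"

fun sat_quants :: "(quant \<times> 's set \<times> nat) list \<Rightarrow> ('s list \<Rightarrow> bool) \<Rightarrow> bool" where
  "sat_quants [] \<Phi> \<longleftrightarrow> \<Phi> []"
| "sat_quants ((QEx, I, j) # ags) \<Phi> \<longleftrightarrow> (\<exists>s\<in>I. sat_quants ags (\<lambda>ss. \<Phi> (s # ss)))"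
| "sat_quants ((QAll, I, j) # ags) \<Phi> \<longleftrightarrow> (\<forall>s\<in>I. sat_quants ags (\<lambda>ss. \<Phi> (s # ss)))"

fun wf_phyper :: "('s, 'a, 'p) mdp \<Rightarrow> ('s, 'p) phyper \<Rightarrow> bool" where
  "wf_phyper M (PHyper n ags \<phi>) \<longleftrightarrow>
     1 \<le> n \<and> n \<le> length ags \<and> (\<forall>(Q, I, j)\<in>set ags. I \<subseteq> states M \<and> j < n) \<and>
     wf_matrix (length ags) \<phi>"

fun sat_phyper :: "('s, 'a, 'p) mdp \<Rightarrow> ('s, 'p) phyper \<Rightarrow> bool" where
  "sat_phyper M (PHyper n ags \<phi>) \<longleftrightarrow>
     (\<exists>\<sigma>s. length \<sigma>s = n \<and> set \<sigma>s \<subseteq> policies M \<and>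
        sat_quants ags (\<lambda>ss.
          sat_matrix
            (prob_ltl (self_comp (length ags) M) (joint_policy (map (\<lambda>(Q, I, j). \<sigma>s ! j) ags)) ss)
            \<phi>))"


section \<open>Finite presentations and their codes\<close>

text \<open>
  A presentation consists of the number of actions and, for every state, its list of atomic
  propositions and, for every action, a successor distribution as a list of pairs of a state and a
  rational probability. States, actions and atomic propositions are numbers.
\<close>

type_synonym mdp_desc = "nat \<times> (nat list \<times> (nat \<times> rat) list list) list"

definition real_row :: "(nat \<times> rat) list \<Rightarrow> (nat \<times> real) list" where
  "real_row = map (\<lambda>(t, q). (t, of_rat q))"

fun wf_desc :: "mdp_desc \<Rightarrow> bool" where
  "wf_desc (k, xs) \<longleftrightarrow>
     k > 0 \<and> xs \<noteq> [] \<and>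
     (\<forall>(ps, rows)\<in>set xs. length rows = k \<and>
        (\<forall>row\<in>set rows. (\<forall>(t, q)\<in>set row. t < length xs) \<and> pmf_of_list_wf (real_row row)))"

fun mdp_of :: "mdp_desc \<Rightarrow> (nat, nat, nat) mdp" where
  "mdp_of (k, xs) =
     \<lparr> states = {..<length xs},
       acts = {..<k},
       trans = (\<lambda>s a. pmf_of_list (real_row (snd (xs ! s) ! a))),
       label = (\<lambda>s. set (fst (xs ! s))) \<rparr>"

lemma is_mdp_mdp_of:
  assumes "wf_desc D"
  shows "is_mdp (mdp_of D)"
proof -
  obtain k xs where D: "D = (k, xs)"
    by (cases D)
  have *: "t < length xs"
    if s: "s < length xs" and a: "a < k"
      and t: "t \<in> set_pmf (pmf_of_list (real_row (snd (xs ! s) ! a)))" for s a t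
  proof -
    obtain ps rows where sx: "xs ! s = (ps, rows)"
      by (cases "xs ! s")
    then have rows: "(ps, rows) \<in> set xs"
      using s by (metis nth_mem)
    have "\<forall>(ps, rows)\<in>set xs. length rows = k \<and>
        (\<forall>row\<in>set rows. (\<forall>(t, q)\<in>set row. t < length xs) \<and> pmf_of_list_wf (real_row row))"
      using assms unfolding D wf_desc.simps by (elim conjE)
    from bspec[OF this rows] have wf: "length rows = k"
      "\<forall>row\<in>set rows. (\<forall>(t, q)\<in>set row. t < length xs) \<and> pmf_of_list_wf (real_row row)"
      by simp_all
    then have "rows ! a \<in> set rows"
      using a by simp
    then have row: "\<forall>(t, q)\<in>set (rows ! a). t < length xs" "pmf_of_list_wf (real_row (rows ! a))"
      using wf(2) by blast+
    have "t \<in> set (map fst (real_row (rows ! a)))"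
      using set_pmf_of_list[OF row(2)] t sx by auto
    then show ?thesis
      using row(1) by (auto simp: real_row_def)
  qed
  show ?thesis
    using assms by (auto simp: is_mdp_def D dest: *)
qed

definition code_list :: "('a \<Rightarrow> nat) \<Rightarrow> 'a list \<Rightarrow> nat" where
  "code_list f xs = list_encode (map f xs)"

definition code_rat :: "rat \<Rightarrow> nat" where
  "code_rat q = prod_encode (map_prod int_encode int_encode (quotient_of q))"

definition code_desc :: "mdp_desc \<Rightarrow> nat" where
  "code_desc = prod_encode \<circ> map_prod id
     (code_list (prod_encode \<circ> map_prod list_encode
       (code_list (code_list (prod_encode \<circ> map_prod id code_rat)))))"

primrec code_ltl :: "(nat \<times> nat) ltl \<Rightarrow> nat" where
  "code_ltl LTrue = prod_encode (0, 0)"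
| "code_ltl (LAtom p) = prod_encode (1, prod_encode p)"
| "code_ltl (LNot \<psi>) = prod_encode (2, code_ltl \<psi>)"
| "code_ltl (LAnd \<psi> \<theta>) = prod_encode (3, prod_encode (code_ltl \<psi>, code_ltl \<theta>))"
| "code_ltl (LNext \<psi>) = prod_encode (4, code_ltl \<psi>)"
| "code_ltl (LUntil \<psi> \<theta>) = prod_encode (5, prod_encode (code_ltl \<psi>, code_ltl \<theta>))"

primrec code_cmp :: "cmp \<Rightarrow> nat" where
  "code_cmp Less = 0"
| "code_cmp LessEq = 1"
| "code_cmp Equal = 2"
| "code_cmp GreaterEq = 3"
| "code_cmp Greater = 4"

primrec code_matrix :: "nat matrix \<Rightarrow> nat" where
  "code_matrix (MAnd \<phi> \<phi>') = prod_encode (0, prod_encode (code_matrix \<phi>, code_matrix \<phi>'))"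
| "code_matrix (MNot \<phi>) = prod_encode (1, code_matrix \<phi>)"
| "code_matrix (MProb \<psi> op c) =
     prod_encode (2, prod_encode (code_ltl \<psi>, prod_encode (code_cmp op, code_rat c)))"

primrec code_quant :: "quant \<Rightarrow> nat" where
  "code_quant QEx = 0"
| "code_quant QAll = 1"

definition code_agent :: "quant \<times> nat set \<times> nat \<Rightarrow> nat" where
  "code_agent = (\<lambda>(Q, I, j). prod_encode (code_quant Q, prod_encode (set_encode I, j)))"

fun code_phyper :: "(nat, nat) phyper \<Rightarrow> nat" where
  "code_phyper (PHyper n ags \<phi>) =
     prod_encode (n, prod_encode (code_list code_agent ags, code_matrix \<phi>))"

definition code_instance :: "mdp_desc \<Rightarrow> (nat, nat) phyper \<Rightarrow> nat" where
  "code_instance D F = prod_encode (code_desc D, code_phyper F)"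

definition phyper_model_checking :: "nat set" where
  "phyper_model_checking =
     {code_instance D F | D F. wf_desc D \<and> wf_phyper (mdp_of D) F \<and> sat_phyper (mdp_of D) F}"

text \<open>Codes of instances are unambiguous.\<close>

lemma inj_code_list: "inj f \<Longrightarrow> inj (code_list f)"
  by (auto simp: inj_def code_list_def list_encode_eq dest: map_injective intro: injI)

lemma inj_code_rat: "inj code_rat"
proof (rule injI)
  fix x y assume "code_rat x = code_rat y"
  then have "quotient_of x = quotient_of y"
    by (auto simp: code_rat_def prod_encode_eq int_encode_eq map_prod_def split: prod.splits)
  then show "x = y"
    by (rule quotient_of_inject)
qed

lemma inj_code_desc: "inj code_desc"
proof -
  have prod_map: "inj (map_prod f g)" if "inj f" "inj g" for f :: "'x \<Rightarrow> nat" and g :: "'y \<Rightarrow> nat"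
    using that by (rule prod.inj_map)
  show ?thesis
    unfolding code_desc_def
    by (intro inj_compose inj_code_list inj_prod_encode prod_map inj_code_rat inj_list_encode inj_on_id)
qed

lemma code_ltl_inject: "code_ltl \<psi> = code_ltl \<theta> \<Longrightarrow> \<psi> = \<theta>"
proof (induction \<psi> arbitrary: \<theta>)
  case LTrue then show ?case by (cases \<theta>) (auto simp: prod_encode_eq)
next
  case LAtom then show ?case by (cases \<theta>) (auto simp: prod_encode_eq)
next
  case LNot then show ?case by (cases \<theta>) (auto simp: prod_encode_eq)
next
  case LAnd then show ?case by (cases \<theta>) (auto simp: prod_encode_eq)
next
  case LNext then show ?case by (cases \<theta>) (auto simp: prod_encode_eq)
next
  case LUntil then show ?case by (cases \<theta>) (auto simp: prod_encode_eq)
qed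

lemma code_matrix_inject: "code_matrix \<phi> = code_matrix \<phi>' \<Longrightarrow> \<phi> = \<phi>'"
proof (induction \<phi> arbitrary: \<phi>')
  case MAnd then show ?case by (cases \<phi>') (auto simp: prod_encode_eq)
next
  case MNot then show ?case by (cases \<phi>') (auto simp: prod_encode_eq)
next
  case (MProb \<psi> op c)
  have "op = op'" if "code_cmp op = code_cmp op'" for op'
    using that by (cases op; cases op') auto
  then show ?case
    using MProb code_ltl_inject injD[OF inj_code_rat] by (cases \<phi>') (auto simp: prod_encode_eq)
qed

lemma code_instance_inject:
  assumes "code_instance D F = code_instance D' F'"
    and "wf_phyper (mdp_of D) F" "wf_phyper (mdp_of D') F'"
  shows "D = D' \<and> F = F'"
proof -
  have D: "D = D'"
    using assms(1) injD[OF inj_code_desc] by (auto simp: code_instance_def prod_encode_eq)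
  obtain n ags \<phi> n' ags' \<phi>' where F: "F = PHyper n ags \<phi>" "F' = PHyper n' ags' \<phi>'"
    by (cases F; cases F')
  have fin: "finite I" if "(Q, I, j) \<in> set ags \<union> set ags'" for Q I j
  proof -
    have "I \<subseteq> states (mdp_of D)"
      using that assms(2,3) F D by auto
    then show ?thesis
      by (cases D) (auto intro: finite_subset)
  qed
  have q: "Q = Q'" if "code_quant Q = code_quant Q'" for Q Q'
    using that by (cases Q; cases Q') auto
  have *: "n = n'" "map code_agent ags = map code_agent ags'" "code_matrix \<phi> = code_matrix \<phi>'"
    using assms(1) F by (auto simp: code_instance_def prod_encode_eq code_list_def list_encode_eq)
  have set: "I = I'" if "set_encode I = set_encode I'" "finite I" "finite I'" for I I'
    using that by (metis set_encode_inverse)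
  have "inj_on code_agent (set ags \<union> set ags')"
  proof (rule inj_onI)
    fix x y
    assume *: "x \<in> set ags \<union> set ags'" "y \<in> set ags \<union> set ags'" "code_agent x = code_agent y"
    obtain Q I j Q' I' j' where xy: "x = (Q, I, j)" "y = (Q', I', j')"
      by (cases x; cases y)
    have "finite I" "finite I'"
      using * fin unfolding xy by blast+
    moreover have "code_quant Q = code_quant Q'" "set_encode I = set_encode I'" "j = j'"
      using *(3) by (simp_all add: xy code_agent_def prod_encode_eq)
    ultimately show "x = y"
      using q set unfolding xy by blast
  qed
  then have "ags = ags'"
    using *(2) inj_on_map_eq_map by blast
  then show ?thesis
    using D F * code_matrix_inject by auto
qed


section \<open>Decidability\<close>

text \<open>Partial recursive functions, with the graph of the denoted function as the semantics.\<close>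

datatype recf =
    Zero
  | Succ
  | Proj nat
  | Comp recf "recf list"
  | PrimRec recf recf
  | Mu recf

inductive rec_eval :: "recf \<Rightarrow> nat list \<Rightarrow> nat \<Rightarrow> bool" where
  zero: "rec_eval Zero xs 0"
| succ: "rec_eval Succ [x] (Suc x)"
| proj: "i < length xs \<Longrightarrow> rec_eval (Proj i) xs (xs ! i)"
| comp: "length ys = length gs \<Longrightarrow> (\<And>i. i < length gs \<Longrightarrow> rec_eval (gs ! i) xs (ys ! i)) \<Longrightarrow>
    rec_eval f ys z \<Longrightarrow> rec_eval (Comp f gs) xs z"
| prim_0: "rec_eval f xs y \<Longrightarrow> rec_eval (PrimRec f g) (0 # xs) y"
| prim_Suc: "rec_eval (PrimRec f g) (n # xs) y \<Longrightarrow> rec_eval g (n # y # xs) z \<Longrightarrow>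
    rec_eval (PrimRec f g) (Suc n # xs) z"
| mu: "rec_eval f (n # xs) 0 \<Longrightarrow> (\<And>k. k < n \<Longrightarrow> \<exists>y. rec_eval f (k # xs) (Suc y)) \<Longrightarrow> rec_eval (Mu f) xs n"

lemma rec_eval_deterministic: "rec_eval f xs y \<Longrightarrow> rec_eval f xs z \<Longrightarrow> y = z"
proof (induction arbitrary: z rule: rec_eval.induct)
  case zero then show ?case by (auto elim: rec_eval.cases)
next
  case succ then show ?case by (auto elim: rec_eval.cases)
next
  case proj then show ?case by (auto elim: rec_eval.cases)
next
  case (comp ys gs xs f y)
  from comp.prems obtain ys' where ys': "length ys' = length gs"
    "\<And>i. i < length gs \<Longrightarrow> rec_eval (gs ! i) xs (ys' ! i)" "rec_eval f ys' z"
    by (cases rule: rec_eval.cases) auto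
  then have "ys = ys'"
    using comp.hyps(1) comp.IH(1) by (auto intro!: nth_equalityI)
  then show ?case
    using comp.IH ys' by blast
next
  case (prim_0 f xs y g)
  from prim_0.prems show ?case by (cases rule: rec_eval.cases) (auto intro: prim_0.IH)
next
  case (prim_Suc f g n xs y z')
  from prim_Suc.prems obtain y' where "rec_eval (PrimRec f g) (n # xs) y'" "rec_eval g (n # y' # xs) z"
    by (cases rule: rec_eval.cases) auto
  then show ?case
    using prim_Suc.IH by blast
next
  case (mu f n xs)
  from mu.prems have z: "rec_eval f (z # xs) 0" "\<And>k. k < z \<Longrightarrow> \<exists>y. rec_eval f (k # xs) (Suc y)"
    by (cases rule: rec_eval.cases; auto)+
  show ?case
  proof (rule linorder_cases[of n z])
    assume "n < z"
    then show ?thesis using z(2) mu.IH(1) by blast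
  next
    assume "z < n"
    then show ?thesis using z(1) mu.IH(2) by blast
  qed
qed

definition decidable :: "nat set \<Rightarrow> bool" where
  "decidable A \<longleftrightarrow> (\<exists>f. \<forall>n. rec_eval f [n] (if n \<in> A then 1 else 0))"

end

theory Submission
  imports Defs
begin

text \<open>
  In a Markov decision process whose states are random letters, a policy maps finite words to
  actions, and since it sees the history of its own replica only, it is an arbitrary relation on
  words. Letting an agent read off a tuple of numbers from its word, the policy becomes a relation
  on numbers. Several agents with the same policy sample this relation at independent random
  arguments, and a formula over their joint path can compare these arguments with each other. As
  every finite prefix of letters has positive probability, \<open>P(\<psi>) = 0\<close> for a co-safety formula
  \<open>\<psi>\<close> says that no arguments whatsoever violate a given universal Horn clause over zero and
  successor. So PHyperLTL expresses that a set of such clauses has a model.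

  A fixed set of Horn clauses axiomatizes the evaluation of codes of partial recursive functions;
  together with the clause "\<open>f\<close> does not yield 1 on its own code", it has a model iff this is true.
  Only the clause that presents the code \<open>e\<close> of \<open>f\<close> varies, so the formula is computable from
  \<open>e\<close>, and a decision procedure for model checking composed with this translation is refuted by
  its value on its own code.
\<close>

section \<open>Paths of positive probability\<close>

lemma step_cong: "(\<And>i. i < n \<Longrightarrow> \<omega> i = \<omega>' i) \<Longrightarrow> step M \<sigma> s0 n \<omega> = step M \<sigma> s0 n \<omega>'"
proof (cases n)
  case (Suc i)
  assume "\<And>i. i < n \<Longrightarrow> \<omega> i = \<omega>' i"
  then have "map \<omega> [0..<Suc i] = map \<omega>' [0..<Suc i]" "\<omega> i = \<omega>' i"
    using Suc by (auto simp del: upt_Suc)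
  then show ?thesis
    unfolding step_def Suc nat.case by metis
qed (simp add: step_def)

definition cylinder :: "nat \<Rightarrow> (nat \<Rightarrow> 's) \<Rightarrow> (nat \<Rightarrow> 's) set" where
  "cylinder n w = {\<omega>. \<forall>i<n. \<omega> i = w i}"

text \<open>The chain rule for prefixes. A prefix determines a point of a discrete finite product,
  and integrating the last kernel over the distribution of shorter prefixes leaves only the
  contribution of that point.\<close>

lemma emeasure_cylinder_Suc:
  fixes M :: "('s::countable, 'a, 'p) mdp"
  shows "emeasure (path_measure M \<sigma> s0) (cylinder (Suc n) w) =
    emeasure (path_measure M \<sigma> s0) (cylinder n w) * pmf (step M \<sigma> s0 n w) (w n)"
proof -
  interpret IT: Ionescu_Tulcea "\<lambda>n \<omega>. measure_pmf (step M \<sigma> s0 n \<omega>)" "\<lambda>_. count_space UNIV"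
    by (rule Ionescu_Tulcea_step)
  let ?N = "\<lambda>n::nat. PiM {0..<n} (\<lambda>_. count_space (UNIV :: 's set))"
  let ?u = "\<lambda>_::nat. undefined :: 's"
  have N: "?N n = count_space (PiE {0..<n} (\<lambda>_. UNIV))" for n
    by (rule count_space_PiM_finite) auto
  have u: "?u \<in> space (?N 0)"
    by (simp add: space_PiM)
  let ?r = "\<lambda>n. restrict w {0..<n}"
  have r: "{?r n} \<in> sets (?N n)" for n
    by (simp add: N)
  \<comment> \<open>A cylinder is the embedding of the singleton \<open>{?r n}\<close>, so its
    measure is that of a finite-dimensional marginal.\<close>
  have cyl: "emeasure (path_measure M \<sigma> s0) (cylinder n w) = emeasure (IT.C 0 n ?u) {?r n}" for n
  proof -
    have emb: "IT.PF.emb UNIV {0..<n} {?r n} = cylinder n w"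
    proof -
      have "restrict \<omega> {0..<n} = ?r n \<longleftrightarrow> (\<forall>i<n. \<omega> i = w i)" for \<omega>
        by (metis atLeastLessThan_iff restrict_apply restrict_ext zero_le)
      then show ?thesis
        by (simp add: prod_emb_def cylinder_def space_PiM vimage_def)
    qed
    have emb2: "IT.PF.emb {0..<n} {0..<n} {?r n} = {?r n}"
      by (rule prod_emb_id) auto
    show ?thesis
      using IT.lim[of "{0..<n}" "{?r n}"] IT.emeasure_CI[of "{0..<n}" n "{?r n}"] r
      by (simp add: path_measure_def emb emb2)
  qed
  have eP: "emeasure (IT.eP n x) {?r (Suc n)} =
      ennreal (pmf (step M \<sigma> s0 n w) (w n)) * indicator {?r n} x"
    if x: "x \<in> space (?N n)" for x
  proof -
    \<comment> \<open>Updating at \<open>n\<close> discards the value of \<open>x\<close> there;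
      extensionality is what makes \<open>x\<close> recoverable from the updated function.\<close>
    have ext: "x \<in> extensional {0..<n}"
      using x by (simp add: space_PiM PiE_def)
    have eq: "x(n := y) = ?r (Suc n) \<longleftrightarrow> x = ?r n \<and> y = w n" for y
    proof
      assume *: "x(n := y) = ?r (Suc n)"
      show "x = ?r n \<and> y = w n"
      proof
        show "y = w n"
          using fun_cong[OF *, of n] by simp
        show "x = ?r n"
        proof
          fix i
          show "x i = ?r n i"
            using fun_cong[OF *, of i] ext by (cases "i < n") (auto simp: extensional_def)
        qed
      qed
    qed (auto simp: fun_eq_iff)
    have "emeasure (IT.eP n x) {?r (Suc n)} =
        emeasure (measure_pmf (step M \<sigma> s0 n x)) {y. x = ?r n \<and> y = w n}"
      using IT.emeasure_eP[OF x r] by (simp add: vimage_def eq)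
    also have "\<dots> = ennreal (pmf (step M \<sigma> s0 n w) (w n)) * indicator {?r n} x"
    proof (cases "x = ?r n")
      case True
      have "step M \<sigma> s0 n x = step M \<sigma> s0 n w"
        by (rule step_cong) (simp add: True)
      then show ?thesis
        using True by (simp add: emeasure_pmf_single)
    qed auto
    finally show ?thesis .
  qed
  have "emeasure (IT.C 0 (Suc n) ?u) {?r (Suc n)} =
      (\<integral>\<^sup>+x. emeasure (IT.eP n x) {?r (Suc n)} \<partial>IT.C 0 n ?u)"
  proof -
    have "space (IT.C 0 n ?u) \<noteq> {}"
      by (rule prob_space.not_empty[OF IT.prob_space_C[OF u]])
    moreover have "IT.eP n \<in> measurable (IT.C 0 n ?u) (subprob_algebra (?N (Suc n)))"
      using IT.measurable_eP[of n] IT.sets_C[OF u, of n] by (simp cong: measurable_cong_sets)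
    ultimately show ?thesis
      using r[of "Suc n"] by (simp add: emeasure_bind)
  qed
  also have "\<dots> = (\<integral>\<^sup>+x. ennreal (pmf (step M \<sigma> s0 n w) (w n)) * indicator {?r n} x \<partial>IT.C 0 n ?u)"
    using IT.space_C[OF u, of n] by (intro nn_integral_cong eP) simp
  also have "\<dots> = ennreal (pmf (step M \<sigma> s0 n w) (w n)) * emeasure (IT.C 0 n ?u) {?r n}"
    using r[of n] IT.sets_C[OF u, of n] by (subst nn_integral_cmult_indicator) auto
  finally show ?thesis
    by (simp add: cyl mult.commute)
qed

lemma cylinder_measurable:
  fixes M :: "('s::countable, 'a, 'p) mdp"
  shows "cylinder n w \<in> sets (path_measure M \<sigma> s0)"
proof -
  let ?N = "\<Pi>\<^sub>M i\<in>(UNIV :: nat set). count_space (UNIV :: 's set)"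
  have "{\<omega> \<in> space ?N. \<forall>i<n. \<omega> i = w i} \<in> sets ?N"
    by measurable
  then show ?thesis
    by (simp add: sets_path_measure space_PiM cylinder_def)
qed

text \<open>The whole path space is the embedding of the one-point product over the empty index set,
  whose marginal has mass 1.\<close>

lemma prob_space_path_measure:
  fixes M :: "('s::countable, 'a, 'p) mdp"
  shows "prob_space (path_measure M \<sigma> s0)"
proof -
  interpret IT: Ionescu_Tulcea "\<lambda>n \<omega>. measure_pmf (step M \<sigma> s0 n \<omega>)" "\<lambda>_. count_space UNIV"
    by (rule Ionescu_Tulcea_step)
  have "IT.PF.emb UNIV {} {\<lambda>_. undefined} = space IT.PF.lim"
    by (auto simp: prod_emb_def space_PiM IT.PF.space_lim)
  then have "emeasure IT.PF.lim (space IT.PF.lim) = emeasure (IT.CI {}) {\<lambda>_. undefined}"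
    using IT.lim[of "{}" "{\<lambda>_. undefined}"] by (simp add: sets_PiM_empty)
  also have "{\<lambda>_. undefined} = space (IT.CI {})"
    by (simp add: IT.CI_def space_PiM)
  also have "emeasure (IT.CI {}) \<dots> = 1"
    using prob_space.emeasure_space_1[OF IT.PF.prob_space_P[of "{}"]] by simp
  finally show ?thesis
    by (intro prob_spaceI) (simp add: path_measure_def)
qed

text \<open>The support of the path measure: the paths all of whose finite prefixes have positive
  probability.\<close>

definition consistent :: "('s, 'a, 'p) mdp \<Rightarrow> ('s, 'a) policy \<Rightarrow> 's \<Rightarrow> (nat \<Rightarrow> 's) \<Rightarrow> bool" where
  "consistent M \<sigma> s0 \<omega> \<longleftrightarrow> (\<forall>n. \<omega> n \<in> set_pmf (step M \<sigma> s0 n \<omega>))"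

lemma emeasure_cylinder_consistent:
  fixes M :: "('s::countable, 'a, 'p) mdp"
  assumes "consistent M \<sigma> s0 w"
  shows "emeasure (path_measure M \<sigma> s0) (cylinder n w) > 0"
proof (induction n)
  case 0
  have "cylinder 0 w = space (path_measure M \<sigma> s0)"
    by (simp add: cylinder_def sets_eq_imp_space_eq[OF sets_path_measure] space_PiM)
  then show ?case
    using prob_space.emeasure_space_1[OF prob_space_path_measure[of M \<sigma> s0]] by simp
next
  case (Suc n)
  have "pmf (step M \<sigma> s0 n w) (w n) > 0"
    using assms by (auto simp: consistent_def set_pmf_eq' )
  then show ?case
    using Suc by (simp add: emeasure_cylinder_Suc ennreal_zero_less_mult_iff)
qed

text \<open>An inconsistent path starts with a finite word whose last letter has probability 0.
  There are only countably many finite words, and the cylinder of each bad one is a null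
  set.\<close>

lemma AE_consistent:
  fixes M :: "('s::countable, 'a, 'p) mdp"
  shows "AE \<omega> in path_measure M \<sigma> s0. consistent M \<sigma> s0 \<omega>"
proof -
  let ?P = "path_measure M \<sigma> s0"
  let ?B = "{(n, xs). length xs = Suc n \<and> xs ! n \<notin> set_pmf (step M \<sigma> s0 n (\<lambda>i. xs ! i))}"
  let ?U = "\<Union>(n, xs)\<in>?B. cylinder (Suc n) (\<lambda>i. xs ! i)"
  have "?U \<in> null_sets ?P"
  proof (rule null_sets_UN')
    fix b assume "b \<in> ?B"
    then obtain n xs where b: "b = (n, xs)" "xs ! n \<notin> set_pmf (step M \<sigma> s0 n (\<lambda>i. xs ! i))"
      by auto
    then show "(case b of (n, xs) \<Rightarrow> cylinder (Suc n) (\<lambda>i. xs ! i)) \<in> null_sets ?P"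
      by (simp add: null_sets_def cylinder_measurable emeasure_cylinder_Suc set_pmf_iff)
  qed simp
  moreover have "{\<omega> \<in> space ?P. \<not> consistent M \<sigma> s0 \<omega>} \<subseteq> ?U"
  proof
    fix \<omega> assume "\<omega> \<in> {\<omega> \<in> space ?P. \<not> consistent M \<sigma> s0 \<omega>}"
    then obtain n where n: "\<omega> n \<notin> set_pmf (step M \<sigma> s0 n \<omega>)"
      by (auto simp: consistent_def)
    let ?xs = "map \<omega> [0..<Suc n]"
    have xs: "?xs ! i = \<omega> i" if "i < Suc n" for i
      using that by (metis add_0 diff_zero nth_map_upt)
    have "step M \<sigma> s0 n (\<lambda>i. ?xs ! i) = step M \<sigma> s0 n \<omega>"
      by (rule step_cong) (simp add: xs del: upt_Suc)
    then have "(n, ?xs) \<in> ?B"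
      using n xs[of n] by (simp del: upt_Suc)
    moreover have "\<omega> \<in> cylinder (Suc n) (\<lambda>i. ?xs ! i)"
      using xs by (simp add: cylinder_def del: upt_Suc)
    ultimately show "\<omega> \<in> ?U"
      by blast
  qed
  ultimately show ?thesis
    by (rule AE_I')
qed

section \<open>Co-safety formulae\<close>

text \<open>Negation is confined to atoms and until is the only temporal fixpoint, so that
  satisfaction is always witnessed by a finite prefix.\<close>

inductive cosafe :: "'p ltl \<Rightarrow> bool" where
  "cosafe LTrue"
| "cosafe (LAtom p)"
| "cosafe (LNot (LAtom p))"
| "cosafe \<psi> \<Longrightarrow> cosafe \<theta> \<Longrightarrow> cosafe (LAnd \<psi> \<theta>)"
| "cosafe \<psi> \<Longrightarrow> cosafe (LNext \<psi>)"
| "cosafe \<psi> \<Longrightarrow> cosafe \<theta> \<Longrightarrow> cosafe (LUntil \<psi> \<theta>)"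

lemma cosafe_prefix:
  assumes "cosafe \<psi>" "sat_ltl w i \<psi>"
  shows "\<exists>n. \<forall>w'. (\<forall>k<n. w' k = w k) \<longrightarrow> sat_ltl w' i \<psi>"
  using assms
proof (induction arbitrary: i rule: cosafe.induct)
  case (2 p)
  then show ?case by (intro exI[of _ "Suc i"]) auto
next
  case (3 p)
  then show ?case by (intro exI[of _ "Suc i"]) auto
next
  case (4 \<psi> \<theta>)
  then obtain n1 n2 where
    "\<forall>w'. (\<forall>k<n1. w' k = w k) \<longrightarrow> sat_ltl w' i \<psi>" "\<forall>w'. (\<forall>k<n2. w' k = w k) \<longrightarrow> sat_ltl w' i \<theta>"
    by (metis sat_ltl.simps(4))
  then show ?case
    by (intro exI[of _ "max n1 n2"]) simp
next
  case (6 \<psi> \<theta>)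
  then obtain j where j: "j \<ge> i" "sat_ltl w j \<theta>" "\<forall>k. i \<le> k \<and> k < j \<longrightarrow> sat_ltl w k \<psi>"
    by auto
  obtain n where n: "\<forall>w'. (\<forall>k<n. w' k = w k) \<longrightarrow> sat_ltl w' j \<theta>"
    using 6(4)[OF j(2)] by (elim exE)
  have "\<forall>k. \<exists>m. i \<le> k \<and> k < j \<longrightarrow> (\<forall>w'. (\<forall>l<m. w' l = w l) \<longrightarrow> sat_ltl w' k \<psi>)"
    using 6(3) j(3) by blast
  then obtain m where m: "\<And>k w'. i \<le> k \<Longrightarrow> k < j \<Longrightarrow> (\<forall>l<m k. w' l = w l) \<Longrightarrow> sat_ltl w' k \<psi>"
    by metis
  \<comment> \<open>The sum of the finitely many prefix lengths is a common bound for all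
    witnesses.\<close>
  have le: "n \<le> n + (\<Sum>k<j. m k)" "k < j \<Longrightarrow> m k \<le> n + (\<Sum>k<j. m k)" for k
    using member_le_sum[of k "{..<j}" m] by (auto intro: trans_le_add2)
  show ?case
  proof (intro exI[of _ "n + (\<Sum>k<j. m k)"] allI impI)
    fix w' assume w': "\<forall>k<n + (\<Sum>k<j. m k). w' k = w k"
    have "sat_ltl w' j \<theta>"
      using n w' le(1) by (meson order_less_le_trans)
    moreover have "sat_ltl w' k \<psi>" if "i \<le> k" "k < j" for k
      by (rule m) (use that w' le(2)[of k] in \<open>auto dest: order_less_le_trans\<close>)
    ultimately show "sat_ltl w' i (LUntil \<psi> \<theta>)"
      using j(1) by auto
  qed
qed (simp_all)

text \<open>The satisfying paths form an open set, and an open set is null exactly if it misses the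
  support: one consistent path in it brings along a whole cylinder of positive measure. This trades
  a probability for a universal quantifier over paths.\<close>

lemma prob_ltl_eq_0_iff:
  fixes M :: "('s::countable, 'a, 'p) mdp"
  assumes "cosafe \<psi>"
  shows "prob_ltl M \<sigma> s0 \<psi> = 0 \<longleftrightarrow>
    (\<forall>\<omega>. consistent M \<sigma> s0 \<omega> \<longrightarrow> \<not> sat_ltl (\<lambda>i. label M (\<omega> i)) 0 \<psi>)"
proof
  let ?P = "path_measure M \<sigma> s0"
  let ?A = "{\<omega>. sat_ltl (\<lambda>i. label M (\<omega> i)) 0 \<psi>}"
  interpret prob_space ?P
    by (rule prob_space_path_measure)
  assume 0: "prob_ltl M \<sigma> s0 \<psi> = 0"
  show "\<forall>\<omega>. consistent M \<sigma> s0 \<omega> \<longrightarrow> \<not> sat_ltl (\<lambda>i. label M (\<omega> i)) 0 \<psi>"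
  proof (intro allI impI notI)
    fix \<omega> assume \<omega>: "consistent M \<sigma> s0 \<omega>" "sat_ltl (\<lambda>i. label M (\<omega> i)) 0 \<psi>"
    obtain n where n: "\<And>w'. (\<forall>k<n. w' k = label M (\<omega> k)) \<Longrightarrow> sat_ltl w' 0 \<psi>"
      using cosafe_prefix[OF assms \<omega>(2)] by blast
    have "cylinder n \<omega> \<subseteq> ?A"
      by (auto simp: cylinder_def intro: n)
    then have "emeasure ?P (cylinder n \<omega>) \<le> emeasure ?P ?A"
      by (rule emeasure_mono) (rule sat_ltl_measurable)
    moreover have "emeasure ?P ?A = 0"
      using 0 by (simp add: prob_ltl_def emeasure_eq_measure)
    ultimately show False
      using emeasure_cylinder_consistent[OF \<omega>(1), of n] by simp
  qed
next
  let ?P = "path_measure M \<sigma> s0"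
  interpret prob_space ?P
    by (rule prob_space_path_measure)
  assume *: "\<forall>\<omega>. consistent M \<sigma> s0 \<omega> \<longrightarrow> \<not> sat_ltl (\<lambda>i. label M (\<omega> i)) 0 \<psi>"
  have "AE \<omega> in ?P. \<omega> \<notin> {\<omega>. sat_ltl (\<lambda>i. label M (\<omega> i)) 0 \<psi>}"
    using AE_consistent[of M \<sigma> s0] * by (auto elim: eventually_mono)
  then show "prob_ltl M \<sigma> s0 \<psi> = 0"
    unfolding prob_ltl_def by (simp add: prob_eq_0 sat_ltl_measurable)
qed

section \<open>Self-composition of the agents\<close>

lemma set_product_pmf:
  "set_pmf (product_pmf ps) =
    {xs. length xs = length ps \<and> (\<forall>k<length ps. xs ! k \<in> set_pmf (ps ! k))}"
proof (induction ps)
  case (Cons p ps)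
  show ?case
  proof (rule set_eqI)
    fix xs
    show "xs \<in> set_pmf (product_pmf (p # ps)) \<longleftrightarrow> xs \<in> {xs. length xs = length (p # ps) \<and>
        (\<forall>k<length (p # ps). xs ! k \<in> set_pmf ((p # ps) ! k))}"
      by (cases xs) (auto simp: Cons nth_Cons split: nat.splits)
  qed
qed auto

text \<open>The support of a product is the product of the supports, and each agent sees its own
  history only, so a joint path is just a tuple of independent consistent paths.\<close>

lemma consistent_self_comp:
  assumes "length \<tau>s = m" "length ss = m"
  shows "consistent (self_comp m M) (joint_policy \<tau>s) ss \<omega> \<longleftrightarrow>
    (\<forall>n. length (\<omega> n) = m) \<and> (\<forall>k<m. consistent M (\<tau>s ! k) (ss ! k) (\<lambda>n. \<omega> n ! k))"
proof -
  have 0: "\<omega> 0 \<in> set_pmf (step (self_comp m M) (joint_policy \<tau>s) ss 0 \<omega>) \<longleftrightarrow>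
      length (\<omega> 0) = m \<and> (\<forall>k<m. \<omega> 0 ! k \<in> set_pmf (step M (\<tau>s ! k) (ss ! k) 0 (\<lambda>n. \<omega> n ! k)))"
    using assms by (auto simp: step_def intro: nth_equalityI)
  \<comment> \<open>The length of the current tuple matters because \<open>map2\<close> cuts its
    arguments to the shorter list; \<open>len\<close> establishes it by induction along the
    path.\<close>
  have Suc: "\<omega> (Suc i) \<in> set_pmf (step (self_comp m M) (joint_policy \<tau>s) ss (Suc i) \<omega>) \<longleftrightarrow>
      length (\<omega> (Suc i)) = m \<and>
      (\<forall>k<m. \<omega> (Suc i) ! k \<in> set_pmf (step M (\<tau>s ! k) (ss ! k) (Suc i) (\<lambda>n. \<omega> n ! k)))"
    if "length (\<omega> i) = m" for i
    using assms that
    by (auto simp: step_def self_comp_def joint_policy_def set_product_pmf o_def simp del: upt_Suc)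
  have len: "length (\<omega> n) = m" if "consistent (self_comp m M) (joint_policy \<tau>s) ss \<omega>" for n
  proof -
    have "\<omega> n \<in> set_pmf (step (self_comp m M) (joint_policy \<tau>s) ss n \<omega>)" for n
      using that by (simp add: consistent_def)
    then show ?thesis
      by (induction n) (metis 0, metis Suc)
  qed
  show ?thesis
  proof (intro iffI conjI allI impI)
    fix k
    assume *: "consistent (self_comp m M) (joint_policy \<tau>s) ss \<omega>" "k < m"
    have "\<omega> n ! k \<in> set_pmf (step M (\<tau>s ! k) (ss ! k) n (\<lambda>n. \<omega> n ! k))" for n
      using * 0 Suc len by (cases n) (auto simp: consistent_def)
    then show "consistent M (\<tau>s ! k) (ss ! k) (\<lambda>n. \<omega> n ! k)"
      by (simp add: consistent_def)
  next
    assume *: "(\<forall>n. length (\<omega> n) = m) \<and> (\<forall>k<m. consistent M (\<tau>s ! k) (ss ! k) (\<lambda>n. \<omega> n ! k))"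
    have "\<omega> n \<in> set_pmf (step (self_comp m M) (joint_policy \<tau>s) ss n \<omega>)" for n
      using * 0 Suc by (cases n) (auto simp: consistent_def)
    then show "consistent (self_comp m M) (joint_policy \<tau>s) ss \<omega>"
      by (simp add: consistent_def)
  qed (rule len)
qed

lemma sat_quants_replicate:
  "sat_quants (replicate m (QEx, {s}, j)) \<Phi> \<longleftrightarrow> \<Phi> (replicate m s)"
  by (induction m arbitrary: \<Phi>) auto

text \<open>The conjunction is never empty, and its last member is kept apart because it will be the
  only one that depends on the input.\<close>

definition null_matrix :: "('p \<times> nat) ltl list \<Rightarrow> ('p \<times> nat) ltl \<Rightarrow> 'p matrix" where
  "null_matrix \<psi>s \<psi> = foldr (\<lambda>\<theta>. MAnd (MProb \<theta> Equal 0)) \<psi>s (MProb \<psi> Equal 0)"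

lemma sat_null_matrix: "sat_matrix P (null_matrix \<psi>s \<psi>) \<longleftrightarrow> (\<forall>\<theta>\<in>insert \<psi> (set \<psi>s). P \<theta> = 0)"
  unfolding null_matrix_def by (induction \<psi>s) auto

lemma wf_null_matrix:
  "wf_matrix m (null_matrix \<psi>s \<psi>) \<longleftrightarrow> (\<forall>\<theta>\<in>insert \<psi> (set \<psi>s). \<forall>(p, k)\<in>set_ltl \<theta>. k < m)"
  unfolding null_matrix_def by (induction \<psi>s) auto

text \<open>All agents share one policy and one initial state. What remains of the formula is a
  policy such that no choice of \<open>m\<close> consistent paths satisfies any of the co-safety
  formulae.\<close>

lemma sat_null_phyper:
  fixes M :: "('s::countable, 'a, 'p) mdp"
  assumes "\<And>\<theta>. \<theta> \<in> insert \<psi> (set \<psi>s) \<Longrightarrow> cosafe \<theta>"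
  shows "sat_phyper M (PHyper 1 (replicate m (QEx, {s}, 0)) (null_matrix \<psi>s \<psi>)) \<longleftrightarrow>
    (\<exists>\<sigma>\<in>policies M. \<forall>\<theta>\<in>insert \<psi> (set \<psi>s). \<forall>\<pi>. (\<forall>k<m. consistent M \<sigma> s (\<pi> k)) \<longrightarrow>
      \<not> sat_ltl (\<lambda>i. {(p, k). k < m \<and> p \<in> label M (\<pi> k i)}) 0 \<theta>)"
    (is "?L \<longleftrightarrow> ?R")
proof -
  let ?P = "\<lambda>\<sigma>. prob_ltl (self_comp m M) (joint_policy (replicate m \<sigma>)) (replicate m s)"
  have "?L \<longleftrightarrow> (\<exists>\<sigma>\<in>policies M. \<forall>\<theta>\<in>insert \<psi> (set \<psi>s). ?P \<sigma> \<theta> = 0)"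
    by (auto simp: sat_quants_replicate sat_null_matrix length_Suc_conv)
  also have "\<dots> \<longleftrightarrow> ?R"
  proof (intro bex_cong ball_cong refl)
    fix \<sigma> \<theta> assume "\<theta> \<in> insert \<psi> (set \<psi>s)"
    then have "cosafe \<theta>"
      by (rule assms)
    note zero = prob_ltl_eq_0_iff[OF this, of "self_comp m M" "joint_policy (replicate m \<sigma>)" "replicate m s"]
    have con: "consistent (self_comp m M) (joint_policy (replicate m \<sigma>)) (replicate m s) \<omega> \<longleftrightarrow>
        (\<forall>n. length (\<omega> n) = m) \<and> (\<forall>k<m. consistent M \<sigma> s (\<lambda>n. \<omega> n ! k))" for \<omega>
      by (subst consistent_self_comp) auto
    show "?P \<sigma> \<theta> = 0 \<longleftrightarrow> (\<forall>\<pi>. (\<forall>k<m. consistent M \<sigma> s (\<pi> k)) \<longrightarrow>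
        \<not> sat_ltl (\<lambda>i. {(p, k). k < m \<and> p \<in> label M (\<pi> k i)}) 0 \<theta>)"
      unfolding zero con
    proof (intro iffI allI impI)
      fix \<pi>
      assume *: "\<forall>\<omega>. (\<forall>n. length (\<omega> n) = m) \<and> (\<forall>k<m. consistent M \<sigma> s (\<lambda>n. \<omega> n ! k)) \<longrightarrow>
          \<not> sat_ltl (\<lambda>i. label (self_comp m M) (\<omega> i)) 0 \<theta>"
        and \<pi>: "\<forall>k<m. consistent M \<sigma> s (\<pi> k)"
      \<comment> \<open>A tuple of paths is transposed into a path of tuples.\<close>
      have "label (self_comp m M) (map (\<lambda>k. \<pi> k i) [0..<m]) = {(p, k). k < m \<and> p \<in> label M (\<pi> k i)}" for i
        by (auto simp: self_comp_def)
      then show "\<not> sat_ltl (\<lambda>i. {(p, k). k < m \<and> p \<in> label M (\<pi> k i)}) 0 \<theta>"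
        using spec[OF *, of "\<lambda>i. map (\<lambda>k. \<pi> k i) [0..<m]"] \<pi> by simp
    next
      fix \<omega>
      assume *: "\<forall>\<pi>. (\<forall>k<m. consistent M \<sigma> s (\<pi> k)) \<longrightarrow>
          \<not> sat_ltl (\<lambda>i. {(p, k). k < m \<and> p \<in> label M (\<pi> k i)}) 0 \<theta>"
        and \<omega>: "(\<forall>n. length (\<omega> n) = m) \<and> (\<forall>k<m. consistent M \<sigma> s (\<lambda>n. \<omega> n ! k))"
      have "label (self_comp m M) (\<omega> i) = {(p, k). k < m \<and> p \<in> label M (\<omega> i ! k)}" for i
        using \<omega> by (auto simp: self_comp_def)
      then show "\<not> sat_ltl (\<lambda>i. label (self_comp m M) (\<omega> i)) 0 \<theta>"
        using spec[OF *, of "\<lambda>k i. \<omega> i ! k"] \<omega> by simp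
    qed
  qed
  finally show ?thesis .
qed

section \<open>The Markov decision process\<close>

text \<open>
  Bit 0 of a state is the action just taken; it makes the actions visible to formulae. The bits 1
  to 4 are a fair random letter.
\<close>

definition letter_mdp :: mdp_desc where
  "letter_mdp = (2, map (\<lambda>q. (filter (bit q) [0..<5],
     map (\<lambda>a. map (\<lambda>s. (2 * s + a, 1 / 16)) [0..<16]) [0..<2])) [0..<32])"

lemma wf_letter_row: "pmf_of_list_wf (real_row (map (\<lambda>s. (2 * s + a, 1 / 16)) [0..<16]))"
  by (rule pmf_of_list_wfI)
    (auto simp: real_row_def o_def of_rat_divide map_replicate_const sum_list_replicate)

lemma wf_letter_mdp: "wf_desc letter_mdp"
  by (auto simp: letter_mdp_def wf_letter_row)

lemma letter_mdp_sel:
  "states (mdp_of letter_mdp) = {..<32}"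
  "acts (mdp_of letter_mdp) = {..<2}"
  "q < 32 \<Longrightarrow> label (mdp_of letter_mdp) q = {i. i < 5 \<and> bit q i}"
  by (auto simp: letter_mdp_def)

lemma set_trans_letter_mdp:
  assumes "q < 32" "a < 2"
  shows "set_pmf (trans (mdp_of letter_mdp) q a) = {t. t < 32 \<and> t mod 2 = a}"
proof -
  let ?row = "real_row (map (\<lambda>s. (2 * s + a, 1 / 16)) [0..<16])"
  have "trans (mdp_of letter_mdp) q a = pmf_of_list ?row"
    using assms by (simp add: letter_mdp_def del: upt_rec_numeral)
  moreover have "set_pmf (pmf_of_list ?row) = fst ` set ?row"
    by (rule set_pmf_of_list_eq[OF wf_letter_row]) (auto simp: real_row_def of_rat_divide)
  moreover have "fst ` set ?row = (\<lambda>s. 2 * s + a) ` {..<16}"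
    by (auto simp: real_row_def image_image)
  moreover have "\<dots> = {t. t < 32 \<and> t mod 2 = a}"
  proof (intro set_eqI iffI)
    fix t assume "t \<in> {t. t < 32 \<and> t mod 2 = a}"
    then have "t = 2 * (t div 2) + a" "t div 2 < 16"
      by auto
    then show "t \<in> (\<lambda>s. 2 * s + a) ` {..<16}"
      by blast
  qed (use assms in auto)
  ultimately show ?thesis
    by simp
qed

text \<open>Only the parity of a state is determined, by the answer of the policy to the history
  before it; the four bits above are free.\<close>

lemma consistent_letter_mdp:
  assumes "\<sigma> \<in> policies (mdp_of letter_mdp)"
  shows "consistent (mdp_of letter_mdp) \<sigma> 0 \<pi> \<longleftrightarrow>
    \<pi> 0 = 0 \<and> (\<forall>n. \<pi> (Suc n) < 32 \<and> \<pi> (Suc n) mod 2 = \<sigma> (map \<pi> [0..<Suc n]))"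
    (is "?L \<longleftrightarrow> ?R")
proof -
  let ?M = "mdp_of letter_mdp"
  \<comment> \<open>A policy is constrained only on histories that consist of states, so the bound
    on all earlier entries has to be carried along.\<close>
  have sS: "\<pi> (Suc n) \<in> set_pmf (step ?M \<sigma> 0 (Suc n) \<pi>) \<longleftrightarrow>
      \<pi> (Suc n) < 32 \<and> \<pi> (Suc n) mod 2 = \<sigma> (map \<pi> [0..<Suc n])" if "\<forall>i\<le>n. \<pi> i < 32" for n
  proof -
    have "set (map \<pi> [0..<Suc n]) \<subseteq> {..<32}"
      using that by (auto simp del: upt_Suc)
    then have "\<sigma> (map \<pi> [0..<Suc n]) < 2"
      using assms by (simp add: policies_def letter_mdp_sel del: upt_Suc)
    then show ?thesis
      using that by (simp add: step_def set_trans_letter_mdp del: upt_Suc)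
  qed
  show ?thesis
  proof
    assume L: ?L
    then have 0: "\<pi> 0 = 0"
      using spec[OF L[unfolded consistent_def], of 0] by (simp add: step_def)
    have "\<forall>i\<le>n. \<pi> i < 32" for n
    proof (induction n)
      case (Suc n)
      then show ?case
        using L sS[of n] by (auto simp: consistent_def le_Suc_eq)
    qed (simp add: 0)
    then show ?R
      using L sS 0 by (auto simp: consistent_def)
  next
    assume R: ?R
    have "\<pi> n < 32" for n
      using R by (cases n) auto
    then have "\<pi> n \<in> set_pmf (step ?M \<sigma> 0 n \<pi>)" for n
      using R sS by (cases n) (auto simp: step_def)
    then show ?L
      by (simp add: consistent_def)
  qed
qed

section \<open>Horn clauses as formulae\<close>

text \<open>Terms are flat, so that a single until formula can compare a term with its
  variable.\<close>

datatype 'v tm = TConst nat | TVar 'v | TSuc 'v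

primrec tm_val :: "('v \<Rightarrow> nat) \<Rightarrow> 'v tm \<Rightarrow> nat" where
  "tm_val \<rho> (TConst c) = c"
| "tm_val \<rho> (TVar v) = \<rho> v"
| "tm_val \<rho> (TSuc v) = Suc (\<rho> v)"

text \<open>
  A clause consists of premises and at most one conclusion; all atoms speak about the same
  four-place relation. Without a conclusion, the premises are contradictory.
\<close>

type_synonym clause = "nat tm list list \<times> nat tm list list"

definition sat_clause :: "(nat list \<Rightarrow> bool) \<Rightarrow> clause \<Rightarrow> bool" where
  "sat_clause R = (\<lambda>(P, Q). \<forall>\<rho>. (\<forall>a\<in>set P. R (map (tm_val \<rho>) a)) \<longrightarrow> (\<exists>a\<in>set Q. R (map (tm_val \<rho>) a)))"

definition wf_clause :: "nat \<Rightarrow> clause \<Rightarrow> bool" where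
  "wf_clause m = (\<lambda>(P, Q). length Q \<le> 1 \<and> 2 * length (P @ Q) \<le> m \<and>
     (\<forall>a\<in>set (P @ Q). length a = 4 \<and> (\<forall>t\<in>set a. \<forall>v\<in>set_tm t. 2 * v + 1 < m)))"

text \<open>The unary representation of numbers on a path. It is partial: a bit that stays 1 forever
  represents no number.\<close>

definition drops :: "(nat \<Rightarrow> 'p set) \<Rightarrow> nat \<Rightarrow> 'p \<Rightarrow> nat \<Rightarrow> bool" where
  "drops w j p n \<longleftrightarrow> (\<forall>i<n. p \<in> w (j + i)) \<and> p \<notin> w (j + n)"

lemma Least_drops: "drops w j p n \<Longrightarrow> (LEAST n. p \<notin> w (j + n)) = n"
  unfolding drops_def by (intro Least_equality) (auto simp: not_less[symmetric])

primrec const_ltl :: "nat \<Rightarrow> 'p \<Rightarrow> 'p ltl" where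
  "const_ltl 0 p = LNot (LAtom p)"
| "const_ltl (Suc c) p = LAnd (LAtom p) (LNext (const_ltl c p))"

text \<open>
  A number is represented by the time of the first 0 of a bit. The atoms of a clause are held by
  the agents with even indices, the variables by those with odd indices.
\<close>

definition var_prop :: "nat \<Rightarrow> nat \<times> nat" where
  "var_prop v = (1, 2 * v + 1)"

text \<open>The until formula follows the bits of the atom and of the variable up to the moment when
  both are 0, having both been 1 before. For a successor, the bit of the atom is read one step ahead
  and must be 1 at the start.\<close>

primrec tm_ltl :: "nat tm \<Rightarrow> nat \<times> nat \<Rightarrow> (nat \<times> nat) ltl" where
  "tm_ltl (TConst c) p = const_ltl c p"
| "tm_ltl (TVar v) p =
     LUntil (LAnd (LAtom p) (LAtom (var_prop v))) (LAnd (LNot (LAtom p)) (LNot (LAtom (var_prop v))))"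
| "tm_ltl (TSuc v) p =
     LAnd (LAtom p) (LUntil (LAnd (LNext (LAtom p)) (LAtom (var_prop v)))
       (LAnd (LNext (LNot (LAtom p))) (LNot (LAtom (var_prop v)))))"

definition conj_ltl :: "'p ltl list \<Rightarrow> 'p ltl" where
  "conj_ltl \<psi>s = foldr LAnd \<psi>s LTrue"

definition args_ltl :: "nat tm list list \<Rightarrow> (nat \<times> nat) ltl" where
  "args_ltl as = conj_ltl (concat (map (\<lambda>k. map (\<lambda>i. tm_ltl (as ! k ! i) (Suc i, 2 * k)) [0..<4])
     [0..<length as]))"

definition low_ltl :: "nat \<Rightarrow> (nat \<times> nat) ltl" where
  "low_ltl n = conj_ltl (concat (map (\<lambda>k. map (\<lambda>i. LNot (LAtom (Suc i, 2 * k))) [0..<4]) [0..<n]))"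

definition answers_ltl :: "nat \<Rightarrow> nat \<Rightarrow> (nat \<times> nat) ltl" where
  "answers_ltl p q = conj_ltl (map (\<lambda>k. LAtom (0, 2 * k)) [0..<p] @
     map (\<lambda>k. LNot (LAtom (0, 2 * (p + k)))) [0..<q])"

text \<open>
  The first letter is not random, hence the outermost next operator. Once all bits of the atoms
  are 0, every agent has seen its arguments completely and its next action is its answer.
\<close>

fun violation :: "clause \<Rightarrow> (nat \<times> nat) ltl" where
  "violation (P, Q) = LNext (LAnd (args_ltl (P @ Q))
     (LUntil LTrue (LAnd (low_ltl (length (P @ Q))) (LNext (answers_ltl (length P) (length Q))))))"

section \<open>Meaning of the building blocks\<close>

lemma sat_conj_ltl: "sat_ltl w j (conj_ltl \<psi>s) \<longleftrightarrow> (\<forall>\<psi>\<in>set \<psi>s. sat_ltl w j \<psi>)"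
  unfolding conj_ltl_def by (induction \<psi>s) auto

lemma sat_args_ltl:
  "sat_ltl w j (args_ltl as) \<longleftrightarrow>
    (\<forall>k<length as. \<forall>i<4. sat_ltl w j (tm_ltl (as ! k ! i) (Suc i, 2 * k)))"
  unfolding args_ltl_def sat_conj_ltl by auto

lemma sat_low_ltl: "sat_ltl w j (low_ltl n) \<longleftrightarrow> (\<forall>k<n. \<forall>i<4. (Suc i, 2 * k) \<notin> w j)"
  unfolding low_ltl_def sat_conj_ltl by auto

lemma sat_answers_ltl:
  "sat_ltl w j (answers_ltl p q) \<longleftrightarrow>
    (\<forall>k<p. (0, 2 * k) \<in> w j) \<and> (\<forall>k<q. (0, 2 * (p + k)) \<notin> w j)"
  unfolding answers_ltl_def sat_conj_ltl by (auto simp: ball_Un)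

lemma sat_const_ltl: "sat_ltl w j (const_ltl c p) \<longleftrightarrow> drops w j p c"
proof (induction c arbitrary: j)
  case (Suc c)
  have "(\<forall>i<Suc c. p \<in> w (j + i)) \<longleftrightarrow> p \<in> w j \<and> (\<forall>i<c. p \<in> w (Suc j + i))"
    by (auto simp: less_Suc_eq_0_disj)
  then show ?case
    by (auto simp: Suc drops_def)
qed (simp add: drops_def)

lemma sat_until_iff:
  "sat_ltl w j (LUntil \<psi> \<theta>) \<longleftrightarrow> (\<exists>n. sat_ltl w (j + n) \<theta> \<and> (\<forall>i<n. sat_ltl w (j + i) \<psi>))"
proof -
  have "(\<forall>k. j \<le> k \<and> k < j + n \<longrightarrow> sat_ltl w k \<psi>) \<longleftrightarrow> (\<forall>i<n. sat_ltl w (j + i) \<psi>)" for n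
    by (metis add_less_cancel_left le_add1 le_iff_add)
  moreover have "(\<exists>k\<ge>j. X k) \<longleftrightarrow> (\<exists>n. X (j + n))" for X
    by (metis le_add1 le_iff_add)
  ultimately show ?thesis
    by (simp only: sat_ltl.simps)
qed

lemma sat_violation:
  "sat_ltl w 0 (violation (P, Q)) \<longleftrightarrow> sat_ltl w 1 (args_ltl (P @ Q)) \<and>
    (\<exists>T. sat_ltl w (1 + T) (low_ltl (length (P @ Q))) \<and>
      sat_ltl w (Suc (1 + T)) (answers_ltl (length P) (length Q)))"
  unfolding violation.simps sat_ltl.simps(5) sat_ltl.simps(4)[of _ _ "args_ltl _"] sat_until_iff
  by simp

lemma sat_tm_ltl:
  "sat_ltl w j (tm_ltl (TConst c) p) \<longleftrightarrow> drops w j p c"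
  "sat_ltl w j (tm_ltl (TVar v) p) \<longleftrightarrow> (\<exists>n. drops w j (var_prop v) n \<and> drops w j p n)"
  "sat_ltl w j (tm_ltl (TSuc v) p) \<longleftrightarrow> (\<exists>n. drops w j (var_prop v) n \<and> drops w j p (Suc n))"
proof -
  have Suc: "(\<forall>i<Suc n. p \<in> w (j + i)) \<longleftrightarrow> p \<in> w j \<and> (\<forall>i<n. p \<in> w (Suc (j + i)))" for n
    by (auto simp: less_Suc_eq_0_disj)
  show "sat_ltl w j (tm_ltl (TVar v) p) \<longleftrightarrow> (\<exists>n. drops w j (var_prop v) n \<and> drops w j p n)"
    unfolding tm_ltl.simps sat_until_iff by (auto simp: drops_def)
  show "sat_ltl w j (tm_ltl (TSuc v) p) \<longleftrightarrow> (\<exists>n. drops w j (var_prop v) n \<and> drops w j p (Suc n))"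
    unfolding tm_ltl.simps sat_ltl.simps(4) sat_until_iff by (auto simp: drops_def Suc)
qed (simp add: sat_const_ltl)

lemma tm_ltlI:
  assumes "\<And>v. v \<in> set_tm t \<Longrightarrow> drops w j (var_prop v) (\<rho> v)" "drops w j p (tm_val \<rho> t)"
  shows "sat_ltl w j (tm_ltl t p)"
  using assms by (cases t) (auto simp: sat_tm_ltl simp del: tm_ltl.simps)

text \<open>Satisfaction forces the bit of every variable in \<open>t\<close> to fall, so the
  default value of \<open>LEAST\<close> never enters the value of the term.\<close>

lemma tm_ltlD:
  assumes "sat_ltl w j (tm_ltl t p)"
  shows "drops w j p (tm_val (\<lambda>v. LEAST n. var_prop v \<notin> w (j + n)) t)"
  using assms by (cases t) (auto simp: sat_tm_ltl Least_drops simp del: tm_ltl.simps)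

section \<open>Co-safety and agent indices of the violation formulae\<close>

lemma cosafe_conj_ltl: "(\<And>\<psi>. \<psi> \<in> set \<psi>s \<Longrightarrow> cosafe \<psi>) \<Longrightarrow> cosafe (conj_ltl \<psi>s)"
  unfolding conj_ltl_def by (induction \<psi>s) (auto intro: cosafe.intros)

lemma cosafe_tm_ltl: "cosafe (tm_ltl t p)"
proof -
  have "cosafe (const_ltl c p)" for c
    by (induction c) (auto intro: cosafe.intros)
  then show ?thesis
    by (cases t) (auto intro!: cosafe.intros)
qed

lemma cosafe_violation: "cosafe (violation c)"
  by (cases c) (auto simp: args_ltl_def low_ltl_def answers_ltl_def
    intro!: cosafe.intros cosafe_conj_ltl cosafe_tm_ltl)

lemma set_conj_ltl: "set_ltl (conj_ltl \<psi>s) = (\<Union>\<psi>\<in>set \<psi>s. set_ltl \<psi>)"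
  unfolding conj_ltl_def by (induction \<psi>s) auto

lemma set_tm_ltl: "set_ltl (tm_ltl t p) \<subseteq> insert p (var_prop ` set_tm t)"
proof -
  have "set_ltl (const_ltl c p) \<subseteq> {p}" for c
    by (induction c) auto
  then show ?thesis
    by (cases t) auto
qed

lemma wf_violation:
  assumes c: "wf_clause m c" and "(p, k) \<in> set_ltl (violation c)"
  shows "k < m"
proof -
  obtain P Q where PQ: "c = (P, Q)"
    by (cases c)
  have even: "2 * k' < m" if "k' < length (P @ Q)" for k'
    using c that by (simp add: wf_clause_def PQ)
  have args: "k < m" if "(p, k) \<in> set_ltl (args_ltl (P @ Q))"
  proof -
    from that obtain k' i where ki: "k' < length (P @ Q)" "i < 4"
      "(p, k) \<in> set_ltl (tm_ltl ((P @ Q) ! k' ! i) (Suc i, 2 * k'))"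
      unfolding args_ltl_def set_conj_ltl set_concat set_map set_upt by fastforce
    have "(P @ Q) ! k' \<in> set (P @ Q)"
      using ki(1) by (rule nth_mem)
    then have a: "length ((P @ Q) ! k') = 4"
      "\<forall>t\<in>set ((P @ Q) ! k'). \<forall>v\<in>set_tm t. 2 * v + 1 < m"
      using c unfolding wf_clause_def PQ by blast+
    then have "(P @ Q) ! k' ! i \<in> set ((P @ Q) ! k')"
      using ki(2) by (metis nth_mem)
    then have "\<forall>v\<in>set_tm ((P @ Q) ! k' ! i). 2 * v + 1 < m"
      using a(2) by blast
    moreover have "(p, k) \<in> insert (Suc i, 2 * k') (var_prop ` set_tm ((P @ Q) ! k' ! i))"
      using ki(3) set_tm_ltl by blast
    ultimately show ?thesis
      using even[OF ki(1)] by (auto simp: var_prop_def)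
  qed
  have "k < m" if "(p, k) \<in> set_ltl (low_ltl (length (P @ Q)))"
    using that even by (auto simp: low_ltl_def set_conj_ltl simp del: length_append)
  moreover have "k < m" if "(p, k) \<in> set_ltl (answers_ltl (length P) (length Q))"
    using that even[of "k div 2"] by (auto simp: answers_ltl_def set_conj_ltl)
  ultimately show ?thesis
    using assms(2) args by (auto simp: PQ)
qed

section \<open>Paths that spell prescribed numbers\<close>

text \<open>Course-of-values recursion: \<open>h n\<close> collects the first \<open>n\<close>
  values. It is needed because the next action depends on the whole history.\<close>

lemma history_recursion: "\<exists>\<pi>. \<forall>n. \<pi> n = f (map \<pi> [0..<n])"
proof -
  define h where "h = rec_nat [] (\<lambda>_ h. h @ [f h])"
  have "map (\<lambda>n. f (h n)) [0..<n] = h n" for n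
    by (induction n) (simp_all add: h_def)
  then show ?thesis
    by (intro exI[of _ "\<lambda>n. f (h n)"]) simp
qed

lemma bit_0_eq_mod_2: "bit (n :: nat) 0 \<longleftrightarrow> n mod 2 = 1"
  by (simp add: bit_0 odd_iff_mod_2_eq_one)

lemma bounded_horner_sum: "horner_sum of_bool 2 bs < (2 :: nat) ^ length bs"
  by (induction bs) auto

text \<open>Whatever the policy answers in bit 0, the other four bits can be chosen so as to spell
  any four numbers in unary from time 1 on.\<close>

lemma ex_run:
  assumes \<sigma>: "\<sigma> \<in> policies (mdp_of letter_mdp)" and xs: "length xs = 4"
  shows "\<exists>\<pi>. consistent (mdp_of letter_mdp) \<sigma> 0 \<pi> \<and> (\<forall>t. \<forall>i<4. bit (\<pi> (Suc t)) (Suc i) \<longleftrightarrow> t < xs ! i)"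
proof -
  \<comment> \<open>After a history of length \<open>Suc t\<close>, the bits compare
    \<open>t\<close> with the numbers; the subtracted 1 accounts for the initial state, which
    carries no information. Five bits keep the state below 32.\<close>
  define f :: "nat list \<Rightarrow> nat" where "f h = (if h = [] then 0 else
      horner_sum of_bool 2 ((\<sigma> h = 1) # map (\<lambda>x. length h - 1 < x) xs))" for h
  obtain \<pi> where \<pi>: "\<And>n. \<pi> n = f (map \<pi> [0..<n])"
    using history_recursion by blast
  have bound: "\<pi> n < 32" for n
    using bounded_horner_sum[of "b # map g xs" for b g] xs \<pi>[of n]
    by (auto simp: f_def split: if_splits)
  have "\<pi> (Suc n) mod 2 = \<sigma> (map \<pi> [0..<Suc n])" for n
  proof -
    have "set (map \<pi> [0..<Suc n]) \<subseteq> {..<32}"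
      using bound by (auto simp del: upt_Suc)
    then have "\<sigma> (map \<pi> [0..<Suc n]) < 2"
      using \<sigma> by (simp add: policies_def letter_mdp_sel del: upt_Suc)
    then show ?thesis
      by (subst \<pi>) (auto simp: f_def simp del: upt_Suc)
  qed
  moreover have "\<pi> 0 = 0"
    by (subst \<pi>) (simp add: f_def)
  ultimately have "consistent (mdp_of letter_mdp) \<sigma> 0 \<pi>"
    using bound by (simp add: consistent_letter_mdp[OF \<sigma>])
  moreover have "bit (\<pi> (Suc t)) (Suc i) \<longleftrightarrow> t < xs ! i" if "i < 4" for t i
    using that xs by (subst \<pi>) (simp add: f_def bit_horner_sum_bit_iff del: upt_Suc horner_sum_simps)
  ultimately show ?thesis
    by blast
qed

text \<open>A policy and a relation on quadruples are converted into each other: a relation is read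
  off from the late answers of the policy, and a policy decodes its history and answers by the
  relation. A violating tuple of paths corresponds to an assignment that falsifies the
  clause.\<close>

lemma horn_reduction:
  assumes wf: "\<And>c. c \<in> insert c0 (set cs) \<Longrightarrow> wf_clause m c"
  shows "sat_phyper (mdp_of letter_mdp)
      (PHyper 1 (replicate m (QEx, {0}, 0)) (null_matrix (map violation cs) (violation c0))) \<longleftrightarrow>
    (\<exists>R. \<forall>c\<in>insert c0 (set cs). sat_clause R c)"
proof -
  let ?M = "mdp_of letter_mdp" and ?C = "insert c0 (set cs)"
  let ?w = "\<lambda>\<pi> i. {(p, k). k < m \<and> p \<in> label ?M (\<pi> k i)}"
  have "cosafe \<theta>" if "\<theta> \<in> insert (violation c0) (set (map violation cs))" for \<theta>
    using that by (auto simp del: violation.simps intro: cosafe_violation)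
  then have "sat_phyper ?M
      (PHyper 1 (replicate m (QEx, {0}, 0)) (null_matrix (map violation cs) (violation c0))) \<longleftrightarrow>
    (\<exists>\<sigma>\<in>policies ?M. \<forall>c\<in>?C. \<forall>\<pi>. (\<forall>k<m. consistent ?M \<sigma> 0 (\<pi> k)) \<longrightarrow> \<not> sat_ltl (?w \<pi>) 0 (violation c))"
    by (subst sat_null_phyper) (auto simp del: violation.simps)
  also have "\<dots> \<longleftrightarrow> (\<exists>R. \<forall>c\<in>?C. sat_clause R c)"
  proof (intro iffI; elim exE bexE)
    fix \<sigma>
    assume \<sigma>: "\<sigma> \<in> policies ?M" and safe: "\<forall>c\<in>?C. \<forall>\<pi>. (\<forall>k<m. consistent ?M \<sigma> 0 (\<pi> k)) \<longrightarrow>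
        \<not> sat_ltl (?w \<pi>) 0 (violation c)"
    \<comment> \<open>One path is fixed for each quadruple, so that agents that hold the same
      numbers give the same answers.\<close>
    obtain run where run: "\<And>xs. length xs = 4 \<Longrightarrow> consistent ?M \<sigma> 0 (run xs)"
      "\<And>xs t i. length xs = 4 \<Longrightarrow> i < 4 \<Longrightarrow> bit (run xs (Suc t)) (Suc i) \<longleftrightarrow> t < xs ! i"
      using ex_run[OF \<sigma>] by metis
    have run_bound: "run xs n < 32" if "length xs = 4" for xs n
      using run(1)[OF that] by (cases n) (auto simp: consistent_letter_mdp[OF \<sigma>])
    \<comment> \<open>The answers of the policy may change with time, hence the quadruple counts as
      related only if all late answers are 1. The answer to the history up to time
      \<open>1 + T\<close> is visible one step later.\<close>
    define R where "R xs \<longleftrightarrow> (\<forall>\<^sub>F T in sequentially. bit (run xs (Suc (Suc T))) 0)" for xs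
    have "sat_clause R c" if c: "c \<in> ?C" for c
    proof -
      obtain P Q where PQ: "c = (P, Q)"
        by (cases c)
      have wfc: "wf_clause m (P, Q)"
        using wf c PQ by blast
      let ?as = "P @ Q"
      have as: "length (?as ! k) = 4" "2 * k < m"
        "\<And>v i. i < 4 \<Longrightarrow> v \<in> set_tm (?as ! k ! i) \<Longrightarrow> 2 * v + 1 < m" if "k < length ?as" for k
      proof -
        have "?as ! k \<in> set ?as"
          using that by (rule nth_mem)
        then have a: "length (?as ! k) = 4" "\<forall>t\<in>set (?as ! k). \<forall>v\<in>set_tm t. 2 * v + 1 < m"
          using wfc unfolding wf_clause_def by blast+
        show "length (?as ! k) = 4" "2 * k < m"
          using a wfc that by (auto simp: wf_clause_def)
        fix v i assume "i < 4" "v \<in> set_tm (?as ! k ! i)"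
        then show "2 * v + 1 < m"
          using a nth_mem[of i "?as ! k"] by auto
      qed
      show ?thesis
        unfolding sat_clause_def PQ prod.case
      proof (intro allI impI)
        fix \<rho> assume P: "\<forall>a\<in>set P. R (map (tm_val \<rho>) a)"
        \<comment> \<open>Odd agents spell the value of their variable in the first bit, even agents
          spell the arguments of their atom; agents without an atom spell zeros.\<close>
        define xs where "xs k = (if odd k then [\<rho> (k div 2), 0, 0, 0]
          else if k div 2 < length ?as then map (tm_val \<rho>) (?as ! (k div 2)) else [0, 0, 0, 0])" for k
        have xs: "length (xs k) = 4" for k
          by (simp add: xs_def as)
        define \<pi> where "\<pi> k = run (xs k)" for k
        have w: "(p, k) \<in> ?w \<pi> i \<longleftrightarrow> k < m \<and> p < 5 \<and> bit (\<pi> k i) p" for p k i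
          using run_bound[OF xs] by (auto simp: letter_mdp_sel \<pi>_def)
        have drops_atom: "drops (?w \<pi>) 1 (Suc i, 2 * k) (tm_val \<rho> (?as ! k ! i))"
          if "k < length ?as" "i < 4" for k i
          unfolding drops_def w using that as[of k] xs[of "2 * k"]
          by (auto simp: \<pi>_def run xs_def)
        have drops_var: "drops (?w \<pi>) 1 (var_prop v) (\<rho> v)" if "2 * v + 1 < m" for v
        proof -
          have "\<pi> (2 * v + 1) = run [\<rho> v, 0, 0, 0]"
            by (simp add: \<pi>_def xs_def)
          then show ?thesis
            unfolding drops_def var_prop_def w using that run(2)[of "[\<rho> v, 0, 0, 0]" 0] by simp
        qed
        have "sat_ltl (?w \<pi>) 1 (tm_ltl (?as ! k ! i) (Suc i, 2 * k))"
          if "k < length ?as" "i < 4" for k i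
          using drops_atom[OF that] drops_var as(3)[OF that] by (intro tm_ltlI) auto
        then have args: "sat_ltl (?w \<pi>) 1 (args_ltl ?as)"
          unfolding sat_args_ltl by blast
        have "\<forall>\<^sub>F T in sequentially. \<forall>k\<in>{..<length ?as}. \<forall>i\<in>{..<4}. tm_val \<rho> (?as ! k ! i) \<le> T"
          by (intro eventually_ball_finite ballI eventually_ge_at_top) auto
        moreover have "\<forall>\<^sub>F T in sequentially. \<forall>a\<in>set P. bit (run (map (tm_val \<rho>) a) (Suc (Suc T))) 0"
          using P by (intro eventually_ball_finite) (auto simp: R_def)
        ultimately have Q: "\<forall>\<^sub>F T in sequentially. \<exists>a\<in>set Q. bit (run (map (tm_val \<rho>) a) (Suc (Suc T))) 0"
        proof eventually_elim
          \<comment> \<open>At so late a time all arguments have been read and all premises are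
            answered by 1. Since the violation formula fails, some conclusion must be answered by
            1.\<close>
          case (elim T)
          have low: "sat_ltl (?w \<pi>) (1 + T) (low_ltl (length ?as))"
            unfolding sat_low_ltl
          proof (intro allI impI)
            fix k i :: nat assume ki: "k < length ?as" "i < 4"
            then have "\<pi> (2 * k) = run (map (tm_val \<rho>) (?as ! k))"
              by (simp add: \<pi>_def xs_def)
            then have "\<not> bit (\<pi> (2 * k) (Suc T)) (Suc i)"
              using elim(1) run(2)[of "map (tm_val \<rho>) (?as ! k)" i T] as(1) ki by (simp add: not_less)
            then show "(Suc i, 2 * k) \<notin> ?w \<pi> (1 + T)"
              unfolding w by simp
          qed
          have "\<forall>k<m. consistent ?M \<sigma> 0 (\<pi> k)"
            using run(1)[OF xs] by (simp add: \<pi>_def)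
          then have "\<not> sat_ltl (?w \<pi>) 0 (violation (P, Q))"
            by (rule spec[OF bspec[OF safe c], of \<pi>, unfolded PQ, THEN mp])
          then have "\<not> sat_ltl (?w \<pi>) (Suc (1 + T)) (answers_ltl (length P) (length Q))"
            using args low unfolding sat_violation by blast
          then obtain k where "k < length P \<and> \<not> bit (\<pi> (2 * k) (Suc (Suc T))) 0 \<or>
              k < length Q \<and> bit (\<pi> (2 * (length P + k)) (Suc (Suc T))) 0"
            unfolding sat_answers_ltl w using as(2) by auto
          moreover have "bit (\<pi> (2 * k) (Suc (Suc T))) 0" if "k < length P"
            using that elim(2) by (simp add: \<pi>_def xs_def nth_append)
          moreover have "\<pi> (2 * (length P + k)) = run (map (tm_val \<rho>) (Q ! k))" if "k < length Q"
            using that by (simp add: \<pi>_def xs_def nth_append)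
          ultimately have "k < length Q" "bit (run (map (tm_val \<rho>) (Q ! k)) (Suc (Suc T))) 0"
            by auto
          then show ?case
            using nth_mem by blast
        qed
        show "\<exists>a\<in>set Q. R (map (tm_val \<rho>) a)"
        proof (cases Q)
          case Nil
          then show ?thesis
            using Q by simp
        next
          \<comment> \<open>Here the Horn form is essential: a sole conclusion is the one answered
            by 1 at every late time, whereas two could alternate.\<close>
          case (Cons a Q')
          then have "Q = [a]"
            using wfc by (simp add: wf_clause_def)
          then show ?thesis
            using Q by (simp add: R_def)
        qed
      qed
    qed
    then show "\<exists>R. \<forall>c\<in>?C. sat_clause R c"
      by blast
  next
    fix R assume R: "\<forall>c\<in>?C. sat_clause R c"
    \<comment> \<open>The policy decodes the first 0 of each bit, skipping the initial state.
      Histories that end before some bit has fallen yield an unspecified but harmless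
      answer.\<close>
    define \<sigma> :: "nat list \<Rightarrow> nat" where
      "\<sigma> h = of_bool (R (map (\<lambda>i. LEAST n. \<not> bit (h ! Suc n) (Suc i)) [0..<4]))" for h
    have \<sigma>: "\<sigma> \<in> policies ?M"
      by (auto simp: policies_def letter_mdp_sel \<sigma>_def)
    have "\<not> sat_ltl (?w \<pi>) 0 (violation c)"
      if c: "c \<in> ?C" and \<pi>: "\<forall>k<m. consistent ?M \<sigma> 0 (\<pi> k)" for c \<pi>
    proof
      assume viol: "sat_ltl (?w \<pi>) 0 (violation c)"
      obtain P Q where PQ: "c = (P, Q)"
        by (cases c)
      have wfc: "wf_clause m (P, Q)"
        using wf c PQ by blast
      let ?as = "P @ Q"
      define \<rho> where "\<rho> v = (LEAST n. var_prop v \<notin> ?w \<pi> (1 + n))" for v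
      have "\<pi> k n < 32" if "k < m" for k n
        using \<pi> that by (cases n) (auto simp: consistent_letter_mdp[OF \<sigma>])
      then have w: "(p, k) \<in> ?w \<pi> i \<longleftrightarrow> k < m \<and> p < 5 \<and> bit (\<pi> k i) p" for p k i
        by (auto simp: letter_mdp_sel)
      have args: "sat_ltl (?w \<pi>) 1 (args_ltl ?as)"
        using viol unfolding PQ sat_violation by blast
      obtain T where low: "sat_ltl (?w \<pi>) (1 + T) (low_ltl (length ?as))"
        and ans: "sat_ltl (?w \<pi>) (Suc (1 + T)) (answers_ltl (length P) (length Q))"
        using viol unfolding PQ sat_violation by blast
      have answer: "bit (\<pi> (2 * k) (Suc (Suc T))) 0 \<longleftrightarrow> R (map (tm_val \<rho>) (?as ! k))"
        if k: "k < length ?as" for k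
      proof -
        have km: "2 * k < m" and len: "length (?as ! k) = 4"
          using wfc k nth_mem[OF k] by (auto simp: wf_clause_def)
        let ?h = "map (\<pi> (2 * k)) [0..<Suc (Suc T)]"
        have "(LEAST n. \<not> bit (?h ! Suc n) (Suc i)) = tm_val \<rho> (?as ! k ! i)" if i: "i < 4" for i
        proof -
          have "sat_ltl (?w \<pi>) 1 (tm_ltl (?as ! k ! i) (Suc i, 2 * k))"
            using args k i unfolding sat_args_ltl by blast
          then have d: "drops (?w \<pi>) 1 (Suc i, 2 * k) (tm_val \<rho> (?as ! k ! i))"
            unfolding \<rho>_def by (rule tm_ltlD)
          have "(Suc i, 2 * k) \<notin> ?w \<pi> (1 + T)"
            using low k i unfolding sat_low_ltl by blast
          \<comment> \<open>Every bit is 1 before its first 0, and at time \<open>1 + T\<close> this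
            bit is 0. So the first 0 lies within \<open>?h\<close>, and decoding does not look
            beyond the end of the history.\<close>
          then have "tm_val \<rho> (?as ! k ! i) \<le> T"
            using d by (force simp: drops_def not_less[symmetric])
          then show ?thesis
            using d km i unfolding drops_def w
            by (intro Least_equality) (auto simp: not_less[symmetric] simp del: upt_Suc)
        qed
        then have "map (\<lambda>i. LEAST n. \<not> bit (?h ! Suc n) (Suc i)) [0..<4] = map (tm_val \<rho>) (?as ! k)"
          using len by (intro nth_equalityI) (simp_all del: upt_Suc)
        moreover have "bit (\<pi> (2 * k) (Suc (Suc T))) 0 \<longleftrightarrow> \<sigma> ?h = 1"
          using \<pi> km by (simp add: bit_0_eq_mod_2 consistent_letter_mdp[OF \<sigma>] del: upt_Suc)
        ultimately show ?thesis
          unfolding \<sigma>_def by simp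
      qed
      have "R (map (tm_val \<rho>) a)" if "a \<in> set P" for a
      proof -
        obtain k where k: "k < length P" "a = P ! k"
          using \<open>a \<in> set P\<close> by (metis in_set_conv_nth)
        then have "(0, 2 * k) \<in> ?w \<pi> (Suc (1 + T))"
          using ans k unfolding sat_answers_ltl by blast
        then show ?thesis
          using answer[of k] k unfolding w by (simp add: nth_append)
      qed
      moreover have "\<not> R (map (tm_val \<rho>) a)" if "a \<in> set Q" for a
      proof -
        obtain k where k: "k < length Q" "a = Q ! k"
          using \<open>a \<in> set Q\<close> by (metis in_set_conv_nth)
        then have "(0, 2 * (length P + k)) \<notin> ?w \<pi> (Suc (1 + T))"
          using ans k unfolding sat_answers_ltl by blast
        moreover have "2 * (length P + k) < m"
          using wfc k by (simp add: wf_clause_def)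
        ultimately show ?thesis
          using answer[of "length P + k"] k unfolding w by (simp add: nth_append)
      qed
      moreover have "sat_clause R (P, Q)"
        using R c unfolding PQ by blast
      then have "(\<forall>a\<in>set P. R (map (tm_val \<rho>) a)) \<longrightarrow> (\<exists>a\<in>set Q. R (map (tm_val \<rho>) a))"
        unfolding sat_clause_def prod.case by (rule spec)
      ultimately show False
        by blast
    qed
    then show "\<exists>\<sigma>\<in>policies ?M. \<forall>c\<in>?C. \<forall>\<pi>. (\<forall>k<m. consistent ?M \<sigma> 0 (\<pi> k)) \<longrightarrow>
        \<not> sat_ltl (?w \<pi>) 0 (violation c)"
      using \<sigma> by blast
  qed
  finally show ?thesis .
qed

section \<open>Recursive functions as a Horn program\<close>

fun recf_code :: "recf \<Rightarrow> nat" where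
  "recf_code Zero = prod_encode (0, 0)"
| "recf_code Succ = prod_encode (1, 0)"
| "recf_code (Proj i) = prod_encode (2, i)"
| "recf_code (Comp f gs) = prod_encode (3, prod_encode (recf_code f, list_encode (map recf_code gs)))"
| "recf_code (PrimRec f g) = prod_encode (4, prod_encode (recf_code f, recf_code g))"
| "recf_code (Mu f) = prod_encode (5, recf_code f)"

abbreviation (input) "pair_atom a b c \<equiv> [TConst 0, a, b, c]"
abbreviation (input) "nth_atom i x y \<equiv> [TConst 1, i, x, y]"
abbreviation (input) "eval_atom f x y \<equiv> [TConst 2, f, x, y]"
abbreviation (input) "evals_atom gs x ys \<equiv> [TConst 3, gs, x, ys]"
abbreviation (input) "search_atom f x n \<equiv> [TConst 4, f, x, n]"
abbreviation (input) "input_atom x \<equiv> [TConst 5, x, TConst 0, TConst 0]"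

text \<open>
  The first argument of an atom selects a relation. \<open>pair_atom\<close> is the graph of \<^const>\<open>prod_encode\<close>,
  \<open>evals_atom\<close> evaluates a list of functions, and \<open>search_atom f x n\<close> says that all values of
  \<open>f\<close> on arguments below \<open>n\<close>, in front of \<open>x\<close>, are positive.
\<close>

definition pair_program :: "clause list" where
  "pair_program = [
    ([], [pair_atom (TConst 0) (TConst 0) (TConst 0)]),
    ([pair_atom (TVar 0) (TSuc 1) (TVar 2)], [pair_atom (TSuc 0) (TVar 1) (TSuc 2)]),
    ([pair_atom (TVar 0) (TConst 0) (TVar 1)], [pair_atom (TConst 0) (TSuc 0) (TSuc 1)]),
    ([pair_atom (TVar 0) (TVar 1) (TVar 2)], [nth_atom (TConst 0) (TSuc 2) (TVar 0)]),
    ([nth_atom (TVar 0) (TVar 1) (TVar 2), pair_atom (TVar 3) (TVar 1) (TVar 4)],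
      [nth_atom (TSuc 0) (TSuc 4) (TVar 2)])]"

text \<open>The rules of \<open>rec_eval\<close> on codes. As terms are flat, each compound code is
  named by a variable that a \<open>pair_atom\<close> defines. \<open>list_encode\<close> yields 0
  or the successor of a pair, whence the zeros and successors in the places of lists.\<close>

definition eval_program :: "clause list" where
  "eval_program = [
    ([], [eval_atom (TConst (prod_encode (0, 0))) (TVar 0) (TConst 0)]),
    ([pair_atom (TVar 0) (TConst 0) (TVar 1)],
      [eval_atom (TConst (prod_encode (1, 0))) (TSuc 1) (TSuc 0)]),
    ([pair_atom (TConst 2) (TVar 0) (TVar 1), nth_atom (TVar 0) (TVar 2) (TVar 3)],
      [eval_atom (TVar 1) (TVar 2) (TVar 3)]),
    ([], [evals_atom (TConst 0) (TVar 0) (TConst 0)]),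
    ([eval_atom (TVar 0) (TVar 1) (TVar 2), evals_atom (TVar 3) (TVar 1) (TVar 4),
      pair_atom (TVar 0) (TVar 3) (TVar 5), pair_atom (TVar 2) (TVar 4) (TVar 6)],
      [evals_atom (TSuc 5) (TVar 1) (TSuc 6)]),
    ([evals_atom (TVar 0) (TVar 1) (TVar 2), eval_atom (TVar 3) (TVar 2) (TVar 4),
      pair_atom (TVar 3) (TVar 0) (TVar 5), pair_atom (TConst 3) (TVar 5) (TVar 6)],
      [eval_atom (TVar 6) (TVar 1) (TVar 4)]),
    ([eval_atom (TVar 0) (TVar 1) (TVar 2), pair_atom (TVar 0) (TVar 3) (TVar 4),
      pair_atom (TConst 4) (TVar 4) (TVar 5), pair_atom (TConst 0) (TVar 1) (TVar 6)],
      [eval_atom (TVar 5) (TSuc 6) (TVar 2)]),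
    ([pair_atom (TVar 0) (TVar 1) (TVar 2), eval_atom (TVar 3) (TSuc 2) (TVar 4),
      pair_atom (TVar 5) (TVar 6) (TVar 7), pair_atom (TConst 4) (TVar 7) (TVar 3),
      pair_atom (TVar 4) (TVar 1) (TVar 8), pair_atom (TVar 0) (TSuc 8) (TVar 9),
      eval_atom (TVar 6) (TSuc 9) (TVar 10), pair_atom (TSuc 0) (TVar 1) (TVar 11)],
      [eval_atom (TVar 3) (TSuc 11) (TVar 10)]),
    ([], [search_atom (TVar 0) (TVar 1) (TConst 0)]),
    ([search_atom (TVar 0) (TVar 1) (TVar 2), pair_atom (TVar 2) (TVar 1) (TVar 3),
      eval_atom (TVar 0) (TSuc 3) (TSuc 4)],
      [search_atom (TVar 0) (TVar 1) (TSuc 2)]),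
    ([search_atom (TVar 0) (TVar 1) (TVar 2), pair_atom (TVar 2) (TVar 1) (TVar 3),
      eval_atom (TVar 0) (TSuc 3) (TConst 0), pair_atom (TConst 5) (TVar 0) (TVar 4)],
      [eval_atom (TVar 4) (TVar 1) (TVar 2)])]"

text \<open>The argument \<open>TSuc 1\<close> stands for the list that consists of the input alone,
  since \<open>list_encode [e] = Suc (prod_encode (e, 0))\<close>.\<close>

definition goal_clause :: clause where
  "goal_clause = ([input_atom (TVar 0), pair_atom (TVar 0) (TConst 0) (TVar 1),
     eval_atom (TVar 0) (TSuc 1) (TConst 1)], [])"

definition input_clause :: "nat \<Rightarrow> clause" where
  "input_clause e = ([], [input_atom (TConst e)])"

definition program :: "clause list" where
  "program = goal_clause # pair_program @ eval_program"

lemma wf_program: "c \<in> insert (input_clause e) (set program) \<Longrightarrow> wf_clause 24 c"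
  by (auto simp: program_def goal_clause_def pair_program_def eval_program_def input_clause_def
      wf_clause_def)

text \<open>Quantifying over all functions with the given code makes atoms about non-codes true. A
  rule thus needs to be checked only where the code in its conclusion denotes a function, and then
  the component codes in its premises do so too.\<close>

fun intended :: "nat \<Rightarrow> nat list \<Rightarrow> bool" where
  "intended e [t, a, b, c] \<longleftrightarrow>
     (t = 0 \<longrightarrow> c = prod_encode (a, b)) \<and>
     (t = 1 \<longrightarrow> a < length (list_decode b) \<and> list_decode b ! a = c) \<and>
     (t = 2 \<longrightarrow> (\<forall>f. recf_code f = a \<longrightarrow> rec_eval f (list_decode b) c)) \<and>
     (t = 3 \<longrightarrow> (\<forall>gs. list_encode (map recf_code gs) = a \<longrightarrow>
        list_all2 (\<lambda>g. rec_eval g (list_decode b)) gs (list_decode c))) \<and>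
     (t = 4 \<longrightarrow> (\<forall>f. recf_code f = a \<longrightarrow> (\<forall>k<c. \<exists>y. rec_eval f (k # list_decode b) (Suc y)))) \<and>
     (t = 5 \<longrightarrow> a = e)"
| "intended e _ \<longleftrightarrow> False"

text \<open>Cantor's enumeration: one step along an antidiagonal, and the passage from the end of
  one to the start of the next. These are the recursive clauses for
  \<open>pair_atom\<close>.\<close>

lemma prod_encode_Suc:
  "prod_encode (Suc a, b) = Suc (prod_encode (a, Suc b))"
  "prod_encode (0, Suc a) = Suc (prod_encode (a, 0))"
  by (simp_all add: prod_encode_def)

lemma recf_code_prod_encode:
  "recf_code f = prod_encode (0, a) \<Longrightarrow> f = Zero"
  "recf_code f = prod_encode (Suc 0, a) \<Longrightarrow> f = Succ"
  "recf_code f = prod_encode (2, a) \<Longrightarrow> f = Proj a"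
  "recf_code f = prod_encode (3, a) \<Longrightarrow> \<exists>g gs. f = Comp g gs \<and> a = prod_encode (recf_code g, list_encode (map recf_code gs))"
  "recf_code f = prod_encode (4, a) \<Longrightarrow> \<exists>g h. f = PrimRec g h \<and> a = prod_encode (recf_code g, recf_code h)"
  "recf_code f = prod_encode (5, a) \<Longrightarrow> \<exists>g. f = Mu g \<and> a = recf_code g"
  by (cases f; simp add: prod_encode_eq)+

lemma intended_pair_program: "c \<in> set pair_program \<Longrightarrow> sat_clause (intended e) c"
  by (auto simp: pair_program_def sat_clause_def prod_encode_Suc prod_encode_eq)
    (simp add: prod_encode_def)

lemma list_encode_eq_0: "list_encode xs = 0 \<longleftrightarrow> xs = []"
  by (cases xs) auto

lemma list_encode_eq_Suc: "list_encode xs = Suc (prod_encode (y, ys)) \<longleftrightarrow>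
  (\<exists>zs. xs = y # zs \<and> list_encode zs = ys)"
  by (cases xs) (auto simp: prod_encode_eq)

text \<open>Each clause mirrors an introduction rule of \<open>rec_eval\<close> or the definition of
  a list evaluation or a search. The tag of a code determines the constructor of the
  function.\<close>

lemma intended_eval_program: "c \<in> set eval_program \<Longrightarrow> sat_clause (intended e) c"
proof -
  have comp: "rec_eval f xs z"
    if "recf_code f = prod_encode (3, prod_encode (b, a))"
      "\<forall>gs. list_encode (map recf_code gs) = a \<longrightarrow> list_all2 (\<lambda>g. rec_eval g xs) gs ys"
      "\<forall>g. recf_code g = b \<longrightarrow> rec_eval g ys z" for f a b xs ys z
  proof -
    from recf_code_prod_encode(4)[OF that(1)] obtain g gs where f: "f = Comp g gs" "b = recf_code g" "a = list_encode (map recf_code gs)"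
      by (auto simp: prod_encode_eq)
    then have "list_all2 (\<lambda>g. rec_eval g xs) gs ys" "rec_eval g ys z"
      using that(2,3) by blast+
    then show ?thesis
      unfolding f(1) by (intro rec_eval.comp[of ys]) (auto simp: list_all2_conv_all_nth)
  qed
  have prim: "rec_eval f (Suc n # xs) z"
    if "recf_code f = prod_encode (4, prod_encode (a, b))"
      "\<forall>f. recf_code f = prod_encode (4, prod_encode (a, b)) \<longrightarrow> rec_eval f (n # xs) y"
      "\<forall>g. recf_code g = b \<longrightarrow> rec_eval g (n # y # xs) z" for f a b n xs y z
  proof -
    from recf_code_prod_encode(5)[OF that(1)] obtain g h where f: "f = PrimRec g h" "b = recf_code h"
      by (auto simp: prod_encode_eq)
    then have "rec_eval f (n # xs) y" "rec_eval h (n # y # xs) z"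
      using that by blast+
    then show ?thesis
      unfolding f(1) by (rule rec_eval.prim_Suc)
  qed
  have evals: "list_all2 (\<lambda>g. rec_eval g xs) gs (y # ys)"
    if "list_encode (map recf_code gs) = Suc (prod_encode (a, b))"
      "\<forall>f. recf_code f = a \<longrightarrow> rec_eval f xs y"
      "\<forall>gs. list_encode (map recf_code gs) = b \<longrightarrow> list_all2 (\<lambda>g. rec_eval g xs) gs ys"
    for gs xs y ys a b
    using that by (auto simp: list_encode_eq_Suc map_eq_Cons_conv)
  have proj: "rec_eval (Proj i) xs y" if "i < length xs" "xs ! i = y" for i xs y
    using rec_eval.proj[OF that(1)] that(2) by simp
  show "c \<in> set eval_program \<Longrightarrow> sat_clause (intended e) c"
    unfolding eval_program_def list.set insert_iff empty_iff
    apply (elim disjE; hypsubst?)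
    apply (simp_all add: sat_clause_def prod_encode_eq)
    subgoal by (auto dest!: recf_code_prod_encode intro: rec_eval.intros)
    subgoal by (auto dest!: recf_code_prod_encode intro: rec_eval.intros)
    subgoal by (auto dest!: recf_code_prod_encode intro: proj)
    subgoal by (auto simp: list_encode_eq_0)
    subgoal using evals by (auto)
    subgoal using comp by blast
    subgoal by (auto dest!: recf_code_prod_encode simp: prod_encode_eq intro: rec_eval.intros)
    subgoal by clarsimp (rule prim; blast)
    subgoal by (auto simp: less_Suc_eq) blast
    subgoal by (auto dest!: recf_code_prod_encode simp: prod_encode_eq intro: rec_eval.intros)
    done
qed

lemma intended_program:
  assumes "\<not> rec_eval f [recf_code f] 1" "c \<in> insert (input_clause (recf_code f)) (set program)"
  shows "sat_clause (intended (recf_code f)) c"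
proof -
  have "sat_clause (intended (recf_code f)) (input_clause (recf_code f))"
    by (simp add: sat_clause_def input_clause_def)
  moreover have "sat_clause (intended (recf_code f)) goal_clause"
    using assms(1) by (auto simp: sat_clause_def goal_clause_def)
  ultimately show ?thesis
    using assms(2) intended_pair_program[of c] intended_eval_program[of c] by (auto simp: program_def)
qed

text \<open>For applying clauses by position; the assignment will be \<open>(!)\<close> of a list,
  which gives the values of the variables in order.\<close>

lemma sat_clause_nth:
  assumes "\<forall>c\<in>set cs. sat_clause R c" "k < length cs" "\<forall>a\<in>set (fst (cs ! k)). R (map (tm_val \<rho>) a)"
  shows "\<exists>a\<in>set (snd (cs ! k)). R (map (tm_val \<rho>) a)"
  using assms nth_mem[OF assms(2)] unfolding sat_clause_def split_def by blast

section \<open>Facts contained in every model of the program\<close>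

context
  fixes R
  assumes pair: "\<forall>c\<in>set pair_program. sat_clause R c"
    and eval: "\<forall>c\<in>set eval_program. sat_clause R c"
begin

lemma R_pair: "R [0, a, b, prod_encode (a, b)]"
proof -
  note rule = sat_clause_nth[OF pair]
  have 1: "R [0, 0, 0, 0]"
    using rule[of 0] by (simp add: pair_program_def)
  have 2: "R [0, a, Suc b, c] \<Longrightarrow> R [0, Suc a, b, Suc c]" for a b c
    using rule[of 1 "(!) [a, b, c]"] by (simp add: pair_program_def)
  have 3: "R [0, a, 0, c] \<Longrightarrow> R [0, 0, Suc a, Suc c]" for a c
    using rule[of 2 "(!) [a, c]"] by (simp add: pair_program_def)
  \<comment> \<open>The outer induction passes from one antidiagonal to the next, the inner one runs
    along it.\<close>
  have "a + b = n \<Longrightarrow> R [0, a, b, prod_encode (a, b)]" for n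
  proof (induction n arbitrary: a b)
    case 0
    then show ?case
      using 1 by (simp add: prod_encode_def)
  next
    case (Suc n)
    then show ?case
    proof (induction a arbitrary: b)
      case 0
      then show ?case
        using 3 by (auto simp: prod_encode_Suc)
    next
      case (Suc a)
      then show ?case
        using 2 by (auto simp: prod_encode_Suc)
    qed
  qed
  then show ?thesis
    by blast
qed

lemma R_nth: "i < length xs \<Longrightarrow> R [1, i, list_encode xs, xs ! i]"
proof (induction xs arbitrary: i)
  case (Cons x xs)
  note rule = sat_clause_nth[OF pair]
  have 1: "R [0, a, b, c] \<Longrightarrow> R [1, 0, Suc c, a]" for a b c
    using rule[of 3 "(!) [a, b, c]"] by (simp add: pair_program_def)
  have 2: "R [1, a, b, c] \<Longrightarrow> R [0, d, b, e] \<Longrightarrow> R [1, Suc a, Suc e, c]" for a b c d e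
    using rule[of 4 "(!) [a, b, c, d, e]"] by (simp add: pair_program_def)
  show ?case
    using Cons 1[OF R_pair] 2[OF _ R_pair] by (cases i) auto
qed simp

text \<open>Induction on the derivation: a model is closed under the clauses, so it contains the
  atom of each true evaluation. The lists supply the codes that the premises name.\<close>

lemma R_eval: "rec_eval f xs y \<Longrightarrow> R [2, recf_code f, list_encode xs, y]"
proof (induction rule: rec_eval.induct)
  note rule = sat_clause_nth[OF eval]
  {
    case (zero xs)
    show ?case
      using rule[of 0 "(!) [list_encode xs]"] by (simp add: eval_program_def)
  next
    case (succ x)
    show ?case
      using rule[of 1 "(!) [x, prod_encode (x, 0)]"] R_pair by (simp add: eval_program_def)
  next
    case (proj i xs)
    then show ?case
      using rule[of 2 "(!) [i, prod_encode (2, i), list_encode xs, xs ! i]"] R_pair R_nth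
      by (simp add: eval_program_def)
  next
    case (comp ys gs xs f z)
    have "R [3, list_encode (map recf_code gs), list_encode xs, list_encode ys]"
      if "length ys = length gs" "\<And>i. i < length gs \<Longrightarrow> R [2, recf_code (gs ! i), list_encode xs, ys ! i]"
      for ys gs
      using that
    proof (induction ys gs rule: list_induct2)
      case Nil
      show ?case
        using rule[of 3 "(!) [list_encode xs]"] by (simp add: eval_program_def)
    next
      case (Cons y ys g gs)
      have "R [2, recf_code g, list_encode xs, y]"
        "R [3, list_encode (map recf_code gs), list_encode xs, list_encode ys]"
        using Cons.prems[of 0] Cons.prems[of "Suc _"] Cons.IH by auto
      then show ?case
        using rule[of 4 "(!) [recf_code g, list_encode xs, y, list_encode (map recf_code gs),
          list_encode ys, prod_encode (recf_code g, list_encode (map recf_code gs)),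
          prod_encode (y, list_encode ys)]"] R_pair
        by (simp add: eval_program_def)
    qed
    then have "R [3, list_encode (map recf_code gs), list_encode xs, list_encode ys]"
      using comp by blast
    then show ?case
      using rule[of 5 "(!) [list_encode (map recf_code gs), list_encode xs, list_encode ys, recf_code f, z,
        prod_encode (recf_code f, list_encode (map recf_code gs)), recf_code (Comp f gs)]"] comp R_pair
      by (simp add: eval_program_def)
  next
    case (prim_0 f xs y g)
    then show ?case
      using rule[of 6 "(!) [recf_code f, list_encode xs, y, recf_code g,
        prod_encode (recf_code f, recf_code g), recf_code (PrimRec f g),
        prod_encode (0, list_encode xs)]"] R_pair
      by (simp add: eval_program_def)
  next
    case (prim_Suc f g n xs y z)
    then show ?case
      using rule[of 7 "(!) [n, list_encode xs, prod_encode (n, list_encode xs), recf_code (PrimRec f g), y,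
        recf_code f, recf_code g, prod_encode (recf_code f, recf_code g),
        prod_encode (y, list_encode xs), prod_encode (n, Suc (prod_encode (y, list_encode xs))), z,
        prod_encode (Suc n, list_encode xs)]"] R_pair
      by (simp add: eval_program_def)
  next
    case (mu f n xs)
    \<comment> \<open>The search relation is climbed from 0 up to \<open>n\<close>, with a positive
      value of \<open>f\<close> at each step.\<close>
    have "i \<le> n \<Longrightarrow> R [4, recf_code f, list_encode xs, i]" for i
    proof (induction i)
      case 0
      show ?case
        using rule[of 8 "(!) [recf_code f, list_encode xs]"] by (simp add: eval_program_def)
    next
      case (Suc i)
      then obtain y where "R [2, recf_code f, list_encode (i # xs), Suc y]"
        using mu by (meson Suc_le_lessD)
      then show ?case
        using rule[of 9 "(!) [recf_code f, list_encode xs, i, prod_encode (i, list_encode xs), y]"]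
          Suc R_pair
        by (simp add: eval_program_def)
    qed
    then show ?case
      using rule[of 10 "(!) [recf_code f, list_encode xs, n, prod_encode (n, list_encode xs),
        recf_code (Mu f)]"] mu R_pair
      by (simp add: eval_program_def)
  }
qed

end

text \<open>If \<open>f\<close> yields 1 on its own code, every model contains this evaluation and
  contradicts \<open>goal_clause\<close>; otherwise the intended meaning is a model.\<close>

lemma program_model_iff:
  "(\<exists>R. \<forall>c\<in>insert (input_clause (recf_code f)) (set program). sat_clause R c) \<longleftrightarrow>
    \<not> rec_eval f [recf_code f] 1"
proof
  let ?e = "recf_code f"
  assume "\<exists>R. \<forall>c\<in>insert (input_clause ?e) (set program). sat_clause R c"
  then obtain R where R: "\<forall>c\<in>insert (input_clause ?e) (set program). sat_clause R c"
    by blast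
  then have pe: "\<forall>c\<in>set pair_program. sat_clause R c" "\<forall>c\<in>set eval_program. sat_clause R c"
    by (auto simp: program_def)
  have "R [5, ?e, 0, 0]"
    using R by (auto simp: sat_clause_def input_clause_def)
  moreover have "sat_clause R goal_clause"
    using R by (simp add: program_def)
  then have "\<not> (R [5, ?e, 0, 0] \<and> R [0, ?e, 0, prod_encode (?e, 0)] \<and>
      R [2, ?e, Suc (prod_encode (?e, 0)), 1])"
    by (auto simp: sat_clause_def goal_clause_def dest!: spec[of _ "(!) [?e, prod_encode (?e, 0)]"])
  ultimately show "\<not> rec_eval f [?e] 1"
    using R_pair[OF pe, of ?e 0] R_eval[OF pe, of f "[?e]" 1] by auto
qed (blast intro: intended_program)

section \<open>Computability of the reduction\<close>

definition computable :: "nat \<Rightarrow> (nat list \<Rightarrow> nat) \<Rightarrow> bool" where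
  "computable k f \<longleftrightarrow> (\<exists>r. \<forall>xs. length xs = k \<longrightarrow> rec_eval r xs (f xs))"

lemma computable_nth: "i < k \<Longrightarrow> computable k (\<lambda>xs. xs ! i)"
  unfolding computable_def using rec_eval.proj by blast

lemma computable_comp:
  assumes "computable (length gs) f" "\<And>g. g \<in> set gs \<Longrightarrow> computable k g"
  shows "computable k (\<lambda>xs. f (map (\<lambda>g. g xs) gs))"
proof -
  obtain r where r: "\<And>ys. length ys = length gs \<Longrightarrow> rec_eval r ys (f ys)"
    using assms(1) by (auto simp: computable_def)
  obtain s where s: "\<And>g xs. g \<in> set gs \<Longrightarrow> length xs = k \<Longrightarrow> rec_eval (s g) xs (g xs)"
    using assms(2) unfolding computable_def by metis
  have "rec_eval (Comp r (map s gs)) xs (f (map (\<lambda>g. g xs) gs))" if "length xs = k" for xs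
    by (rule rec_eval.comp[of "map (\<lambda>g. g xs) gs"]) (simp_all add: r s that)
  then show ?thesis
    unfolding computable_def by blast
qed

lemma computable_Suc:
  assumes "computable k f"
  shows "computable k (\<lambda>xs. Suc (f xs))"
proof -
  have "computable (length [f]) (\<lambda>ys. Suc (ys ! 0))"
    unfolding computable_def using rec_eval.succ by (intro exI[of _ Succ]) (auto simp: length_Suc_conv)
  from computable_comp[OF this, of k] show ?thesis
    using assms by simp
qed

lemma computable_const: "computable k (\<lambda>_. c)"
proof (induction c)
  case 0
  show ?case
    unfolding computable_def using rec_eval.zero by blast
qed (rule computable_Suc)

text \<open>As in \<open>PrimRec\<close>, argument 0 of \<open>g\<close> is the counter and argument
  1 the previous value; the parameters follow.\<close>

lemma computable_rec:
  assumes f: "computable k f" and g: "computable (Suc (Suc k)) g" and n: "computable k n"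
  shows "computable k (\<lambda>xs. rec_nat (f xs) (\<lambda>i y. g (i # y # xs)) (n xs))"
proof -
  obtain r s where r: "\<And>xs. length xs = k \<Longrightarrow> rec_eval r xs (f xs)"
    and s: "\<And>xs. length xs = Suc (Suc k) \<Longrightarrow> rec_eval s xs (g xs)"
    using f g by (auto simp: computable_def)
  have rs: "rec_eval (PrimRec r s) (i # xs) (rec_nat (f xs) (\<lambda>i y. g (i # y # xs)) i)"
    if "length xs = k" for i xs
  proof (induction i)
    case 0
    show ?case
      using r[OF that] by (simp add: rec_eval.prim_0)
  next
    case (Suc i)
    then show ?case
      using s[of "i # _ # xs"] that by (auto intro: rec_eval.prim_Suc)
  qed
  obtain t where t: "\<And>xs. length xs = k \<Longrightarrow> rec_eval t xs (n xs)"
    using n by (auto simp: computable_def)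
  \<comment> \<open>\<open>PrimRec\<close> recurses on its first argument, so composition puts
    \<open>n xs\<close> in front of the unchanged parameters.\<close>
  have "rec_eval (Comp (PrimRec r s) (t # map Proj [0..<k])) xs
      (rec_nat (f xs) (\<lambda>i y. g (i # y # xs)) (n xs))" if xs: "length xs = k" for xs
  proof (rule rec_eval.comp)
    show "length (n xs # xs) = length (t # map Proj [0..<k])"
      using xs by simp
    show "rec_eval ((t # map Proj [0..<k]) ! i) xs ((n xs # xs) ! i)"
      if "i < length (t # map Proj [0..<k])" for i
      using that xs t by (auto simp: nth_Cons' intro: rec_eval.proj)
  qed (rule rs[OF xs])
  then show ?thesis
    unfolding computable_def by blast
qed

lemma computable_add:
  assumes "computable k f" "computable k g"
  shows "computable k (\<lambda>xs. f xs + g xs)"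
proof -
  have "rec_nat m (\<lambda>_ y. Suc y) n = n + m" for m n
    by (induction n) auto
  then show ?thesis
    using computable_rec[of k g "\<lambda>xs. Suc (xs ! 1)" f] assms
    by (simp add: computable_Suc computable_nth)
qed

lemma computable_triangle:
  assumes "computable k f"
  shows "computable k (\<lambda>xs. triangle (f xs))"
proof -
  have "rec_nat 0 (\<lambda>i y. y + Suc i) n = triangle n" for n
    by (induction n) auto
  moreover have "computable (Suc (Suc k)) (\<lambda>xs. xs ! 1 + Suc (xs ! 0))"
    by (intro computable_add computable_Suc computable_nth) auto
  ultimately show ?thesis
    using computable_rec[of k "\<lambda>_. 0" "\<lambda>xs. xs ! 1 + Suc (xs ! 0)" f] assms
    by (simp add: computable_const)
qed

lemma computable_prod_encode:
  assumes "computable k f" "computable k g"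
  shows "computable k (\<lambda>xs. prod_encode (f xs, g xs))"
  unfolding prod_encode_def prod.case
  by (intro computable_add computable_triangle assms)

lemmas computable_intros = computable_const computable_prod_encode

text \<open>A unary constant arises by iterating one constructor, so its code is a primitive
  recursion over pairing. Only through it will the input enter the formula.\<close>

lemma computable_const_ltl:
  assumes "computable k f"
  shows "computable k (\<lambda>xs. code_ltl (const_ltl (f xs) p))"
proof -
  let ?a = "code_ltl (LAtom p)"
  let ?g = "\<lambda>xs. prod_encode (3, prod_encode (?a, prod_encode (4, xs ! 1)))"
  have "rec_nat (code_ltl (const_ltl 0 p)) (\<lambda>_ y. ?g [0, y]) n = code_ltl (const_ltl n p)" for n
    by (induction n) auto
  moreover have "computable (Suc (Suc k)) ?g"
    by (intro computable_intros computable_nth) simp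
  ultimately show ?thesis
    using computable_rec[of k "\<lambda>_. code_ltl (const_ltl 0 p)" ?g f] assms
    by (simp add: computable_const)
qed

text \<open>No clause has more than 9 atoms or 12 variables, so 24 agents suffice.\<close>

definition reduction :: "nat \<Rightarrow> (nat, nat) phyper" where
  "reduction e = PHyper 1 (replicate 24 (QEx, {0}, 0))
     (null_matrix (map violation program) (violation (input_clause e)))"

lemma computable_reduction: "computable 1 (\<lambda>xs. code_instance letter_mdp (reduction (xs ! 0)))"
proof -
  \<comment> \<open>The sole atom of the clause has the arguments 5, \<open>e\<close>, 0, 0, held by
    agent 0; everything except \<open>const_ltl e\<close> is fixed.\<close>
  have viol: "violation (input_clause e) = LNext (LAnd
      (LAnd (const_ltl 5 (1, 0)) (LAnd (const_ltl e (2, 0))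
        (LAnd (const_ltl 0 (3, 0)) (LAnd (const_ltl 0 (4, 0)) LTrue))))
      (LUntil LTrue (LAnd (low_ltl 1) (LNext (answers_ltl 0 1)))))" for e
    by (simp add: input_clause_def args_ltl_def conj_ltl_def upt_rec numeral_eq_Suc)
  have "computable 1 (\<lambda>xs. code_ltl (violation (input_clause (xs ! 0))))"
    unfolding viol code_ltl.simps
    by (intro computable_intros computable_const_ltl computable_nth) simp
  then have "computable 1 (\<lambda>xs. code_matrix (null_matrix \<psi>s (violation (input_clause (xs ! 0)))))" for \<psi>s
    unfolding null_matrix_def
    by (induction \<psi>s) (auto intro!: computable_intros simp del: violation.simps)
  then show ?thesis
    unfolding reduction_def code_instance_def code_phyper.simps
    by (intro computable_intros)
qed

lemma wf_reduction: "wf_phyper (mdp_of letter_mdp) (reduction e)"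
proof -
  have "k < 24" if "(p, k) \<in> set_ltl (violation (input_clause e))" for p k
    by (rule wf_violation[OF wf_program[OF insertI1] that])
  moreover have "k < 24" if "c \<in> set program" "(p, k) \<in> set_ltl (violation c)" for c p k
    by (rule wf_violation[OF wf_program[OF insertI2[OF that(1)]] that(2)])
  ultimately show ?thesis
    by (auto simp: reduction_def letter_mdp_sel wf_null_matrix simp del: violation.simps)
qed

lemma reduction_correct:
  "code_instance letter_mdp (reduction (recf_code f)) \<in> phyper_model_checking \<longleftrightarrow>
    \<not> rec_eval f [recf_code f] 1"
proof -
  let ?F = "reduction (recf_code f)"
  have "code_instance letter_mdp ?F \<in> phyper_model_checking \<longleftrightarrow> sat_phyper (mdp_of letter_mdp) ?F"
    unfolding phyper_model_checking_def
    using wf_letter_mdp wf_reduction code_instance_inject[of letter_mdp ?F] by blast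
  also have "\<dots> \<longleftrightarrow> \<not> rec_eval f [recf_code f] 1"
    unfolding reduction_def
    by (subst horn_reduction) (rule wf_program, assumption, rule program_model_iff)
  finally show ?thesis .
qed

theorem theorem3p1:
  shows "\<not> decidable phyper_model_checking"
proof
  let ?A = phyper_model_checking and ?h = "\<lambda>e. code_instance letter_mdp (reduction e)"
  assume "decidable ?A"
  then obtain d where d: "\<And>n. rec_eval d [n] (if n \<in> ?A then 1 else 0)"
    by (auto simp: decidable_def)
  obtain r where r: "\<And>e. rec_eval r [e] (?h e)"
    using computable_reduction unfolding computable_def by (metis length_Cons list.size(3) nth_Cons_0 One_nat_def)
  \<comment> \<open>On its own code, \<open>?f\<close> asks \<open>d\<close> whether
    \<open>?f\<close> fails to yield 1 on its own code, and returns that answer.\<close>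
  let ?f = "Comp d [r]"
  let ?e = "recf_code ?f"
  have f: "rec_eval ?f [?e] (if ?h ?e \<in> ?A then 1 else 0)"
  proof (rule rec_eval.comp)
    show "rec_eval d [?h ?e] (if ?h ?e \<in> ?A then 1 else 0)"
      by (rule d)
  qed (simp_all add: r del: recf_code.simps)
  show False
  proof (cases "?h ?e \<in> ?A")
    case True
    then show False
      using f reduction_correct[of ?f] by simp
  next
    case False
    then have "rec_eval ?f [?e] 1"
      using reduction_correct[of ?f] by blast
    then show False
      using rec_eval_deterministic[OF f] False by auto
  qed
qed

end
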